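(* Let $k$ be a field of characteristic $\neq 2$, let $\mathcal A=k[t,t^{-1},(1-t)^{-1}]\subset k(t)$, $t'=1-t^{-1}$, $t''=(1-t)^{-1}$, and $\mathfrak g=\mathfrak{sl}_2(k)\otimes_k\mathcal A$. Let $x=\begin{pmatrix}-1&2\\0&1\end{pmatrix}$, $y=\begin{pmatrix}-1&0\\-2&1\end{pmatrix}$, $z=\begin{pmatrix}1&0\\0&-1\end{pmatrix}$. Define: <ul> <li>$\varphi_{\mathfrak s}$: the linear map of $\mathfrak{sl}_2(k)$ with $x\mapsto y$, $y\mapsto z$, $z\mapsto x$; and $\varphi_{\mathcal A}$: the $k$-algebra endomorphism of $\mathcal A$ with $\varphi_{\mathcal A}(t)=t'$;</li> <li>$\tau_{\mathfrak s}$: the linear map of $\mathfrak{sl}_2(k)$ with $x\mapsto -x$, $y\mapsto -z$, $z\mapsto -y$; and $\tau_{\mathcal A}$: the $k$-algebra endomorphism of $\mathcal A$ with $\tau_{\mathcal A}(t)=1-t$;</li> <li>$\tau_1$: the $\mathcal A$-linear map of $\mathfrak g$ with $\tau_1(x\otimes 1)=-x\otimes 1$, $\tau_1(y\otimes 1)=-(z\otimes t'+x\otimes(t'-1))$, $\tau_1(z\otimes 1)=x\otimes t''+y\otimes(t''-1)$;</li> <li>$\tau_2$: the $\mathcal A$-linear map of $\mathfrak g$ with $\tau_2(x\otimes 1)=y\otimes t+z\otimes(t-1)$, $\tau_2(y\otimes 1)=-y\otimes 1$, $\tau_2(z\otimes 1)=-(x\otimes t''+y\otimes(t''-1))$.</li>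 </ul> Then $\varphi_{\mathfrak s}$ and $\tau_{\mathfrak s}$ are automorphisms of $\mathfrak{sl}_2(k)$ of orders $3$ and $2$, $\varphi_{\mathcal A}$ and $\tau_{\mathcal A}$ are automorphisms of the $k$-algebra $\mathcal A$ of orders $3$ and $2$, $\tau_1,\tau_2$ are automorphisms of $\mathfrak g$ as a Lie algebra over $\mathcal A$, and there is an injective group homomorphism $\rho:S_4\to\mathrm{Aut}_k(\mathfrak g)$ (where $S_4$ is the group of permutations of $\{0,1,2,3\}$) with $\rho((123))=\varphi_{\mathfrak s}\otimes\varphi_{\mathcal A}$, $\rho((12))=\tau_{\mathfrak s}\otimes\tau_{\mathcal A}$, $\rho((12)(30))=\tau_1$, $\rho((23)(10))=\tau_2$. (In particular $\rho((123))$ and $\rho((12))$ are $\mathcal A$-semilinear with associated automorphisms $\varphi_{\mathcal A}$, $\tau_{\mathcal A}$, i.e. $\rho((123))(ga)=\rho((123))(g)\varphi_{\mathcal A}(a)$ and similarly for $(12)$.) Moreover, for the homomorphism $\Psi:\mathfrak g_\boxtimes\to\mathfrak g$ described in the context, $\Psi(\sigma(X))=\rho(\sigma)(\Psi(X))$ for all $\sigma\in S_4$ and $X\in\mathfrak g_\boxtimes$.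
   Context: The Tetrahedron algebra $\mathfrak g_\boxtimes$ is the Lie algebra over $k$ with generators $X_{ij}$ ($i,j\in\{0,1,2,3\}$, $i\neq j$) subject to the relations $X_{ij}+X_{ji}=0$ for $i\ne j$; $[X_{ij},X_{jk}]=2(X_{ij}+X_{jk})$ for mutually distinct $i,j,k$; and $[X_{hi},[X_{hi},[X_{hi},X_{jk}]]]=4[X_{hi},X_{jk}]$ for mutually distinct $h,i,j,k$. The group $S_4$ acts on $\mathfrak g_\boxtimes$ by automorphisms via $\sigma(X_{ij})=X_{\sigma(i)\sigma(j)}$. $\Psi:\mathfrak g_\boxtimes\to\mathfrak g$ is the Lie algebra homomorphism determined by $\Psi(X_{12})=x\otimes1$, $\Psi(X_{23})=y\otimes 1$, $\Psi(X_{31})=z\otimes 1$, $\Psi(X_{03})=y\otimes t+z\otimes(t-1)$, $\Psi(X_{01})=z\otimes t'+x\otimes(t'-1)$, $\Psi(X_{02})=x\otimes t''+y\otimes(t''-1)$. Permutations are written in cycle notation, e.g. $(12)(30)$ swaps $1\leftrightarrow2$ and $3\leftrightarrow0$. *)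

theory Defs
  imports "HOL-Analysis.Finite_Cartesian_Product"
          "HOL-Computational_Algebra.Polynomial_Factorial"
          "HOL-Computational_Algebra.Fraction_Field"
          "HOL-Combinatorics.Permutations"
          "HOL-Combinatorics.Transposition"
begin

definition mat2 :: "'f \<Rightarrow> 'f \<Rightarrow> 'f \<Rightarrow> 'f \<Rightarrow> 'f ^ 2 ^ 2" where
  "mat2 a b c d = (\<chi> i j. if i = 1 then (if j = 1 then a else b) else (if j = 1 then c else d))"

definition smat :: "'f::times \<Rightarrow> 'f ^ 2 ^ 2 \<Rightarrow> 'f ^ 2 ^ 2" where
  "smat c M = (\<chi> i j. c * M $ i $ j)"

definition brk :: "'f::comm_ring_1 ^ 2 ^ 2 \<Rightarrow> 'f ^ 2 ^ 2 \<Rightarrow> 'f ^ 2 ^ 2" where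
  "brk M N = M ** N - N ** M"

definition trace0 :: "'f::comm_ring_1 ^ 2 ^ 2 \<Rightarrow> bool" where
  "trace0 M \<longleftrightarrow> M $ 1 $ 1 + M $ 2 $ 2 = 0"

definition xm :: "'f::comm_ring_1 ^ 2 ^ 2" where "xm = mat2 (-1) 2 0 1"
definition ym :: "'f::comm_ring_1 ^ 2 ^ 2" where "ym = mat2 (-1) 0 (-2) 1"
definition zm :: "'f::comm_ring_1 ^ 2 ^ 2" where "zm = mat2 1 0 0 (-1)"

text \<open>Coordinates of a traceless matrix M = cx M x + cy M y + cz M z
  (x,y,z is a basis of sl2 when 2 is invertible).\<close>
definition cx :: "'f::field ^ 2 ^ 2 \<Rightarrow> 'f" where "cx M = M $ 1 $ 2 / 2"
definition cy :: "'f::field ^ 2 ^ 2 \<Rightarrow> 'f" where "cy M = - (M $ 2 $ 1 / 2)"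
definition cz :: "'f::field ^ 2 ^ 2 \<Rightarrow> 'f" where "cz M = M $ 1 $ 1 + M $ 1 $ 2 / 2 - M $ 2 $ 1 / 2"

definition sl2 :: "('k::field ^ 2 ^ 2) set" where "sl2 = {M. trace0 M}"

definition lin3 :: "'f::field ^ 2 ^ 2 \<Rightarrow> 'f ^ 2 ^ 2 \<Rightarrow> 'f ^ 2 ^ 2 \<Rightarrow> 'f ^ 2 ^ 2 \<Rightarrow> 'f ^ 2 ^ 2" where
  "lin3 u v w M = smat (cx M) u + smat (cy M) v + smat (cz M) w"

type_synonym 'k rf = "'k poly fract"

definition emb :: "'k::field \<Rightarrow> 'k rf" where "emb c = to_fract [:c:]"

definition T :: "'k::field rf" where "T = to_fract [:0, 1:]"

definition t1 :: "'k::field rf" where "t1 = 1 - 1 / T"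
definition t2 :: "'k::field rf" where "t2 = 1 / (1 - T)"

text \<open>A = k[t, t^-1, (1-t)^-1]: the k-subalgebra of k(t) generated by t, 1/t, 1/(1-t).\<close>
definition Aset :: "'k::field rf set" where
  "Aset = {to_fract p / (T ^ a * (1 - T) ^ b) | p a b. True}"

definition subst_rf :: "'k::field rf \<Rightarrow> 'k rf \<Rightarrow> 'k rf" where
  "subst_rf s r = (SOME v. \<exists>p q. r = Fract p q \<and> q \<noteq> 0 \<and> poly (map_poly emb q) s \<noteq> 0 \<and>
      v = poly (map_poly emb p) s / poly (map_poly emb q) s)"

definition phiA :: "'k::field rf \<Rightarrow> 'k rf" where "phiA = subst_rf t1"
definition tauA :: "'k::field rf \<Rightarrow> 'k rf" where "tauA = subst_rf (1 - T)"

section \<open>g = sl2(k) tensor A, identified with traceless matrices with entries in A\<close>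

definition lift :: "'k::field ^ 2 ^ 2 \<Rightarrow> 'k rf ^ 2 ^ 2" where
  "lift M = (\<chi> i j. emb (M $ i $ j))"

text \<open>x tensor a corresponds to smat a (lift x).\<close>
definition gset :: "('k::field rf ^ 2 ^ 2) set" where
  "gset = {M. trace0 M \<and> (\<forall>i j. M $ i $ j \<in> Aset)}"

definition X :: "'k::field rf ^ 2 ^ 2" where "X = lift xm"
definition Y :: "'k::field rf ^ 2 ^ 2" where "Y = lift ym"
definition Z :: "'k::field rf ^ 2 ^ 2" where "Z = lift zm"

text \<open>Tensor product f tensor h of a k-linear map f of sl2(k) and a map h of A.\<close>
definition tens :: "('k::field ^ 2 ^ 2 \<Rightarrow> 'k ^ 2 ^ 2) \<Rightarrow> ('k rf \<Rightarrow> 'k rf) \<Rightarrow> 'k rf ^ 2 ^ 2 \<Rightarrow> 'k rf ^ 2 ^ 2" where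
  "tens f h M = smat (h (cx M)) (lift (f xm)) + smat (h (cy M)) (lift (f ym)) + smat (h (cz M)) (lift (f zm))"

definition phiS :: "'k::field ^ 2 ^ 2 \<Rightarrow> 'k ^ 2 ^ 2" where "phiS = lin3 ym zm xm"
definition tauS :: "'k::field ^ 2 ^ 2 \<Rightarrow> 'k ^ 2 ^ 2" where "tauS = lin3 (- xm) (- zm) (- ym)"

definition tau1 :: "'k::field rf ^ 2 ^ 2 \<Rightarrow> 'k rf ^ 2 ^ 2" where
  "tau1 = lin3 (- X) (- (smat t1 Z + smat (t1 - 1) X)) (smat t2 X + smat (t2 - 1) Y)"
definition tau2 :: "'k::field rf ^ 2 ^ 2 \<Rightarrow> 'k rf ^ 2 ^ 2" where
  "tau2 = lin3 (smat T Y + smat (T - 1) Z) (- Y) (- (smat t2 X + smat (t2 - 1) Y))"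

definition lie_aut :: "'f::field set \<Rightarrow> ('f ^ 2 ^ 2) set \<Rightarrow> ('f ^ 2 ^ 2 \<Rightarrow> 'f ^ 2 ^ 2) \<Rightarrow> bool" where
  "lie_aut K S f \<longleftrightarrow> bij_betw f S S \<and>
     (\<forall>c\<in>K. \<forall>M\<in>S. \<forall>N\<in>S. f (smat c M + N) = smat c (f M) + f N) \<and>
     (\<forall>M\<in>S. \<forall>N\<in>S. f (brk M N) = brk (f M) (f N))"

definition alg_aut_A :: "('k::field rf \<Rightarrow> 'k rf) \<Rightarrow> bool" where
  "alg_aut_A f \<longleftrightarrow> bij_betw f Aset Aset \<and>
     (\<forall>a\<in>Aset. \<forall>b\<in>Aset. f (a + b) = f a + f b \<and> f (a * b) = f a * f b) \<and>
     (\<forall>c. f (emb c) = emb c)"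

definition order_on :: "'a set \<Rightarrow> ('a \<Rightarrow> 'a) \<Rightarrow> nat \<Rightarrow> bool" where
  "order_on S f n \<longleftrightarrow> 0 < n \<and> (\<forall>s\<in>S. (f ^^ n) s = s) \<and>
     (\<forall>m. 0 < m \<and> m < n \<longrightarrow> (\<exists>s\<in>S. (f ^^ m) s \<noteq> s))"

definition S4 :: "(nat \<Rightarrow> nat) set" where "S4 = {\<sigma>. \<sigma> permutes {0, 1, 2, 3}}"

definition c123 :: "nat \<Rightarrow> nat" where
  "c123 i = (if i = 1 then 2 else if i = 2 then 3 else if i = 3 then 1 else i)"

definition lie_algebra :: "('k::field \<Rightarrow> 'l::ab_group_add \<Rightarrow> 'l) \<Rightarrow> ('l \<Rightarrow> 'l \<Rightarrow> 'l) \<Rightarrow> bool" where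
  "lie_algebra sc lb \<longleftrightarrow>
     (\<forall>a u v. sc a (u + v) = sc a u + sc a v) \<and>
     (\<forall>a b u. sc (a + b) u = sc a u + sc b u) \<and>
     (\<forall>a b u. sc (a * b) u = sc a (sc b u)) \<and>
     (\<forall>u. sc 1 u = u) \<and>
     (\<forall>u v w. lb (u + v) w = lb u w + lb v w) \<and>
     (\<forall>u v w. lb u (v + w) = lb u v + lb u w) \<and>
     (\<forall>a u v. lb (sc a u) v = sc a (lb u v)) \<and>
     (\<forall>a u v. lb u (sc a v) = sc a (lb u v)) \<and>
     (\<forall>u. lb u u = 0) \<and>
     (\<forall>u v w. lb u (lb v w) + lb v (lb w u) + lb w (lb u v) = 0)"

inductive_set lie_span :: "('k \<Rightarrow> 'l::ab_group_add \<Rightarrow> 'l) \<Rightarrow> ('l \<Rightarrow> 'l \<Rightarrow> 'l) \<Rightarrow> 'l set \<Rightarrow> 'l set"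
  for sc lb G where
    gen: "u \<in> G \<Longrightarrow> u \<in> lie_span sc lb G"
  | zero: "0 \<in> lie_span sc lb G"
  | add: "u \<in> lie_span sc lb G \<Longrightarrow> v \<in> lie_span sc lb G \<Longrightarrow> u + v \<in> lie_span sc lb G"
  | scale: "u \<in> lie_span sc lb G \<Longrightarrow> sc a u \<in> lie_span sc lb G"
  | brk: "u \<in> lie_span sc lb G \<Longrightarrow> v \<in> lie_span sc lb G \<Longrightarrow> lb u v \<in> lie_span sc lb G"

definition tetra_gen :: "('k::field \<Rightarrow> 'l::ab_group_add \<Rightarrow> 'l) \<Rightarrow> ('l \<Rightarrow> 'l \<Rightarrow> 'l) \<Rightarrow> (nat \<Rightarrow> nat \<Rightarrow> 'l) \<Rightarrow> bool" where
  "tetra_gen sc lb Xg \<longleftrightarrow> lie_algebra sc lb \<and>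
     (\<forall>i\<in>{0..3}. \<forall>j\<in>{0..3}. i \<noteq> j \<longrightarrow> Xg i j + Xg j i = 0) \<and>
     (\<forall>i\<in>{0..3}. \<forall>j\<in>{0..3}. \<forall>k\<in>{0..3}. distinct [i, j, k] \<longrightarrow>
        lb (Xg i j) (Xg j k) = sc 2 (Xg i j + Xg j k)) \<and>
     (\<forall>h\<in>{0..3}. \<forall>i\<in>{0..3}. \<forall>j\<in>{0..3}. \<forall>k\<in>{0..3}. distinct [h, i, j, k] \<longrightarrow>
        lb (Xg h i) (lb (Xg h i) (lb (Xg h i) (Xg j k))) = sc 4 (lb (Xg h i) (Xg j k))) \<and>
     lie_span sc lb {Xg i j | i j. i \<in> {0..3} \<and> j \<in> {0..3} \<and> i \<noteq> j} = UNIV"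

definition tetra_action :: "('k::field \<Rightarrow> 'l::ab_group_add \<Rightarrow> 'l) \<Rightarrow> ('l \<Rightarrow> 'l \<Rightarrow> 'l) \<Rightarrow> (nat \<Rightarrow> nat \<Rightarrow> 'l)
     \<Rightarrow> ((nat \<Rightarrow> nat) \<Rightarrow> 'l \<Rightarrow> 'l) \<Rightarrow> bool" where
  "tetra_action sc lb Xg act \<longleftrightarrow> (\<forall>\<sigma>\<in>S4. bij (act \<sigma>) \<and>
     (\<forall>a u v. act \<sigma> (sc a u + v) = sc a (act \<sigma> u) + act \<sigma> v) \<and>
     (\<forall>u v. act \<sigma> (lb u v) = lb (act \<sigma> u) (act \<sigma> v)) \<and>
     (\<forall>i\<in>{0..3}. \<forall>j\<in>{0..3}. i \<noteq> j \<longrightarrow> act \<sigma> (Xg i j) = Xg (\<sigma> i) (\<sigma> j)))"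

definition is_Psi :: "('k::field \<Rightarrow> 'l::ab_group_add \<Rightarrow> 'l) \<Rightarrow> ('l \<Rightarrow> 'l \<Rightarrow> 'l) \<Rightarrow> (nat \<Rightarrow> nat \<Rightarrow> 'l)
     \<Rightarrow> ('l \<Rightarrow> 'k rf ^ 2 ^ 2) \<Rightarrow> bool" where
  "is_Psi sc lb Xg Psi \<longleftrightarrow>
     (\<forall>a u v. Psi (sc a u + v) = smat (emb a) (Psi u) + Psi v) \<and>
     (\<forall>u v. Psi (lb u v) = brk (Psi u) (Psi v)) \<and>
     Psi (Xg 1 2) = X \<and> Psi (Xg 2 3) = Y \<and> Psi (Xg 3 1) = Z \<and>
     Psi (Xg 0 3) = smat T Y + smat (T - 1) Z \<and>
     Psi (Xg 0 1) = smat t1 Z + smat (t1 - 1) X \<and>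
     Psi (Xg 0 2) = smat t2 X + smat (t2 - 1) Y"

end

theory Submission
  imports Defs "HOL-Analysis.Cartesian_Space"
begin

text \<open>
  Put \<open>p\<^sub>1 = \<infinity>\<close>, \<open>p\<^sub>2 = 1\<close>, \<open>p\<^sub>3 = 0\<close>, \<open>p\<^sub>0 = 1/t\<close> on the projective line over \<open>k(t)\<close>. The image of
  \<open>X\<^sub>i\<^sub>j\<close> under \<open>\<Psi>\<close> is the traceless matrix \<open>E\<^sub>i\<^sub>j\<close> with eigenlines \<open>p\<^sub>i\<close>, \<open>p\<^sub>j\<close> for the eigenvalues \<open>-1\<close>, \<open>1\<close>.
  For any four distinct points, \<open>E\<^sub>a\<^sub>d = r E\<^sub>c\<^sub>d + (r - 1) E\<^sub>d\<^sub>b\<close> where \<open>r\<close> is their cross-ratio, which for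
  \<open>(p\<^sub>0, p\<^sub>1, p\<^sub>2, p\<^sub>3)\<close> equals \<open>t\<close>. So \<open>\<rho>(\<sigma>)\<close> is the semilinear map that sends \<open>E\<^sub>1\<^sub>2, E\<^sub>2\<^sub>3, E\<^sub>3\<^sub>1\<close> to
  their \<open>\<sigma>\<close>-translates and \<open>t\<close> to the cross-ratio of the permuted points; the relation then forces
  \<open>\<rho>(\<sigma>) E\<^sub>i\<^sub>j = E\<^bsub>\<sigma>(i)\<sigma>(j)\<^esub>\<close> for all edges. Applying \<open>\<rho>(\<sigma>)\<close> to the same relation for \<open>\<pi>\<close> shows that
  the substitutions compose, whence \<open>\<rho>\<close> is a homomorphism; it is injective because \<open>E\<^sub>i\<^sub>j\<close>
  determines its eigenlines.
\<close>

section \<open>Two-by-two matrices in coordinates\<close>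

lemma mat_eq_iff:
  "M = N \<longleftrightarrow> M $ 1 $ 1 = N $ 1 $ 1 \<and> M $ 1 $ 2 = N $ 1 $ 2 \<and>
     M $ 2 $ 1 = N $ 2 $ 1 \<and> M $ 2 $ 2 = N $ 2 $ 2" for M N :: "'f ^ 2 ^ 2"
  by (auto simp: vec_eq_iff forall_2)

lemma mat2_nth [simp]:
  "mat2 a b c d $ 1 $ 1 = a" "mat2 a b c d $ 1 $ 2 = b"
  "mat2 a b c d $ 2 $ 1 = c" "mat2 a b c d $ 2 $ 2 = d"
  by (auto simp: mat2_def)

lemma smat_nth [simp]: "smat c M $ i $ j = c * M $ i $ j"
  by (simp add: smat_def)

lemma brk_nth:
  "brk M N $ i $ j = M $ i $ 1 * N $ 1 $ j + M $ i $ 2 * N $ 2 $ j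
     - (N $ i $ 1 * M $ 1 $ j + N $ i $ 2 * M $ 2 $ j)"
  by (simp add: brk_def matrix_matrix_mult_def sum_2)

lemma smat_one [simp]: "smat (1::'f::comm_ring_1) M = M"
  and smat_zero_left [simp]: "smat (0::'f) M = 0"
  and smat_zero_right [simp]: "smat (c::'f) 0 = 0"
  and smat_smat: "smat c (smat d M) = smat (c * d) M"
  and smat_add_left: "smat (c + d) M = smat c M + smat d M"
  and smat_add_right: "smat c (M + N) = smat c M + smat c N"
  by (simp_all add: mat_eq_iff algebra_simps)

lemma lin_coords [simp]:
  fixes M N :: "'f::field ^ 2 ^ 2"
  shows "cx (M + N) = cx M + cx N" "cy (M + N) = cy M + cy N" "cz (M + N) = cz M + cz N"
    "cx (- M) = - cx M" "cy (- M) = - cy M" "cz (- M) = - cz M"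
    "cx (smat c M) = c * cx M" "cy (smat c M) = c * cy M" "cz (smat c M) = c * cz M"
  by (simp_all add: cx_def cy_def cz_def field_simps add_divide_distrib)

lemma coords_basis [simp]:
  assumes "(2::'f::field) \<noteq> 0"
  shows "cx (xm :: 'f^2^2) = 1" "cy (xm :: 'f^2^2) = 0" "cz (xm :: 'f^2^2) = 0"
    "cx (ym :: 'f^2^2) = 0" "cy (ym :: 'f^2^2) = 1" "cz (ym :: 'f^2^2) = 0"
    "cx (zm :: 'f^2^2) = 0" "cy (zm :: 'f^2^2) = 0" "cz (zm :: 'f^2^2) = 1"
  using assms by (simp_all add: cx_def cy_def cz_def xm_def ym_def zm_def)

lemma trace0_iff: "trace0 M \<longleftrightarrow> M $ 2 $ 2 = - M $ 1 $ 1"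
  by (simp add: trace0_def eq_neg_iff_add_eq_0 add.commute)

lemma trace0_expand:
  fixes M :: "'f::field ^ 2 ^ 2"
  assumes "(2::'f) \<noteq> 0" "trace0 M"
  shows "M = smat (cx M) xm + smat (cy M) ym + smat (cz M) zm"
proof -
  have "M $ 1 $ 2 = 2 * (M $ 1 $ 2 / 2)" "M $ 2 $ 1 = 2 * (M $ 2 $ 1 / 2)"
    using assms(1) by simp_all
  then show ?thesis
    using assms(2) by (simp add: trace0_iff mat_eq_iff xm_def ym_def zm_def cx_def cy_def cz_def)
qed

lemma trace0_lin3: "trace0 u \<Longrightarrow> trace0 v \<Longrightarrow> trace0 w \<Longrightarrow>
    trace0 (smat a u + smat b v + smat c w)"
  by (simp add: trace0_iff algebra_simps)

lemma trace0_basis [simp]: "trace0 xm" "trace0 ym" "trace0 zm"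
  by (simp_all add: trace0_def xm_def ym_def zm_def)

lemma trace0_neg [simp]: "trace0 (- M) \<longleftrightarrow> trace0 M"
  by (auto simp: trace0_iff minus_equation_iff)

lemma trace0_add: "trace0 M \<Longrightarrow> trace0 N \<Longrightarrow> trace0 (M + N)"
  by (simp add: trace0_iff algebra_simps)

lemma trace0_smat: "trace0 M \<Longrightarrow> trace0 (smat c M)"
  by (simp add: trace0_iff algebra_simps)

lemma trace0_brk: "trace0 (brk M N)"
  by (simp add: trace0_iff brk_nth algebra_simps)

definition sl2_triple :: "'f::comm_ring_1 ^ 2 ^ 2 \<Rightarrow> 'f ^ 2 ^ 2 \<Rightarrow> 'f ^ 2 ^ 2 \<Rightarrow> bool" where
  "sl2_triple u v w \<longleftrightarrow> brk u v = smat 2 (u + v) \<and> brk v w = smat 2 (v + w) \<and> brk w u = smat 2 (w + u)"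

lemma brk_bilinear:
  fixes M N L :: "'f::comm_ring_1 ^ 2 ^ 2"
  shows "brk (M + N) L = brk M L + brk N L" "brk L (M + N) = brk L M + brk L N"
    "brk (smat c M) L = smat c (brk M L)" "brk L (smat c M) = smat c (brk L M)"
  by (simp_all add: mat_eq_iff brk_nth algebra_simps)

lemma brk_self [simp]: "brk M M = 0"
  by (simp add: brk_def)

lemma brk_swap: "brk M N = - brk N M"
  by (simp add: brk_def)

lemma sl2_triple_brk:
  fixes u v w :: "'f::comm_ring_1 ^ 2 ^ 2"
  assumes "sl2_triple u v w"
  shows "brk (smat a u + smat b v + smat c w) (smat a' u + smat b' v + smat c' w) =
    smat (2 * (a*b' - b*a' + c*a' - a*c')) u + smat (2 * (a*b' - b*a' + b*c' - c*b')) v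
      + smat (2 * (b*c' - c*b' + c*a' - a*c')) w"
proof -
  have uv: "brk u v = smat 2 (u + v)" "brk v u = - smat 2 (u + v)"
    and vw: "brk v w = smat 2 (v + w)" "brk w v = - smat 2 (v + w)"
    and wu: "brk w u = smat 2 (w + u)" "brk u w = - smat 2 (w + u)"
    using assms brk_swap unfolding sl2_triple_def by metis+
  show ?thesis
    by (simp add: brk_bilinear uv vw wu) (simp add: mat_eq_iff algebra_simps)
qed

lemma sl2_triple_basis: "sl2_triple xm ym zm"
  by (simp add: sl2_triple_def mat_eq_iff brk_nth xm_def ym_def zm_def)

lemma coords_brk:
  fixes M N :: "'f::field ^ 2 ^ 2"
  assumes "(2::'f) \<noteq> 0" "trace0 M" "trace0 N"
  shows "cx (brk M N) = 2 * (cx M * cy N - cy M * cx N + cz M * cx N - cx M * cz N)"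
    "cy (brk M N) = 2 * (cx M * cy N - cy M * cx N + cy M * cz N - cz M * cy N)"
    "cz (brk M N) = 2 * (cy M * cz N - cz M * cy N + cz M * cx N - cx M * cz N)"
proof -
  have "brk M N = brk (smat (cx M) xm + smat (cy M) ym + smat (cz M) zm)
      (smat (cx N) xm + smat (cy N) ym + smat (cz N) zm)"
    using trace0_expand[OF assms(1,2)] trace0_expand[OF assms(1,3)] by simp
  also note sl2_triple_brk[OF sl2_triple_basis]
  finally show "cx (brk M N) = 2 * (cx M * cy N - cy M * cx N + cz M * cx N - cx M * cz N)"
    "cy (brk M N) = 2 * (cx M * cy N - cy M * cx N + cy M * cz N - cz M * cy N)"
    "cz (brk M N) = 2 * (cy M * cz N - cz M * cy N + cz M * cx N - cx M * cz N)"
    using assms(1) by simp_all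
qed

lemma two_neq_zero_of_CHAR:
  assumes "CHAR('f::field) \<noteq> 2"
  shows "(2::'f) \<noteq> 0"
proof
  assume "(2::'f) = 0"
  then have "CHAR('f) dvd 2"
    using of_nat_eq_0_iff_char_dvd[of 2, where 'a='f] by simp
  then have "CHAR('f) = 1 \<or> CHAR('f) = 2"
    using two_is_prime_nat by (metis prime_nat_iff)
  then show False
    using assms by simp
qed

section \<open>Automorphisms of the constant Lie algebra\<close>

lemma lie_aut_lin3:
  fixes u v w :: "'f::field ^ 2 ^ 2"
  assumes "(2::'f) \<noteq> 0" "sl2_triple u v w" "bij_betw (lin3 u v w) sl2 sl2"
  shows "lie_aut UNIV sl2 (lin3 u v w)"
  unfolding lie_aut_def
proof (intro conjI ballI assms(3))
  show "lin3 u v w (smat c M + N) = smat c (lin3 u v w M) + lin3 u v w N" for c M N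
    by (simp add: lin3_def mat_eq_iff algebra_simps)
  show "lin3 u v w (brk M N) = brk (lin3 u v w M) (lin3 u v w N)"
    if "M \<in> sl2" "N \<in> sl2" for M N
    using that by (simp add: lin3_def coords_brk[OF assms(1)] sl2_def sl2_triple_brk[OF assms(2)])
qed

lemma bij_betw_if_funpow_id:
  assumes "\<And>s. s \<in> S \<Longrightarrow> f s \<in> S" "\<And>s. s \<in> S \<Longrightarrow> (f ^^ Suc n) s = s"
  shows "bij_betw f S S"
proof (rule bij_betw_byWitness[where f' = "f ^^ n"])
  have "(f ^^ m) s \<in> S" if "s \<in> S" for m s
    using that assms(1) by (induction m) auto
  then show "(f ^^ n) ` S \<subseteq> S"
    by blast
qed (use assms in \<open>auto simp: funpow_swap1\<close>)

lemma phiS_tauS_basis: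
  assumes "(2::'k::field) \<noteq> 0"
  shows "phiS (xm :: 'k^2^2) = ym" "phiS (ym :: 'k^2^2) = zm" "phiS (zm :: 'k^2^2) = xm"
    "tauS (xm :: 'k^2^2) = - xm" "tauS (ym :: 'k^2^2) = - zm" "tauS (zm :: 'k^2^2) = - ym"
  using assms by (simp_all add: phiS_def tauS_def lin3_def)

lemma coords_phiS_tauS:
  assumes "(2::'k::field) \<noteq> 0"
  shows "cx (phiS M :: 'k^2^2) = cz M" "cy (phiS M :: 'k^2^2) = cx M" "cz (phiS M :: 'k^2^2) = cy M"
    "cx (tauS M :: 'k^2^2) = - cx M" "cy (tauS M :: 'k^2^2) = - cz M" "cz (tauS M :: 'k^2^2) = - cy M"
  using assms by (simp_all add: phiS_def tauS_def lin3_def)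

lemma trace0_coords_eqI:
  fixes M N :: "'f::field ^ 2 ^ 2"
  assumes "(2::'f) \<noteq> 0" "trace0 M" "trace0 N" "cx M = cx N" "cy M = cy N" "cz M = cz N"
  shows "M = N"
  by (metis assms trace0_expand)

lemma phiS_tauS_in_sl2:
  "phiS M \<in> sl2" "tauS M \<in> sl2"
  unfolding phiS_def tauS_def lin3_def sl2_def by (auto intro!: trace0_lin3)

lemma phiS_tauS_funpow:
  assumes "(2::'k::field) \<noteq> 0" "M \<in> (sl2 :: ('k^2^2) set)"
  shows "phiS (phiS (phiS M)) = M" "tauS (tauS M) = M"
proof -
  have t: "trace0 M" "\<And>N. trace0 (phiS N :: 'k^2^2)" "\<And>N. trace0 (tauS N :: 'k^2^2)"
    using assms(2) phiS_tauS_in_sl2 unfolding sl2_def by auto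
  show "phiS (phiS (phiS M)) = M"  "tauS (tauS M) = M"
    by (rule trace0_coords_eqI[OF assms(1)]; simp add: t coords_phiS_tauS[OF assms(1)])+
qed

lemma basis_neq:
  assumes "(2::'k::field) \<noteq> 0"
  shows "(ym :: 'k^2^2) \<noteq> xm" "(zm :: 'k^2^2) \<noteq> xm" "(zm :: 'k^2^2) \<noteq> - ym"
  using assms by (auto simp: mat_eq_iff xm_def ym_def zm_def)

lemma less_3_cases: "0 < m \<and> m < (3::nat) \<longleftrightarrow> m = 1 \<or> m = 2"
  by auto

lemma constant_automorphisms:
  assumes "(2::'k::field) \<noteq> 0"
  shows "lie_aut (UNIV :: 'k set) sl2 (phiS :: 'k ^ 2 ^ 2 \<Rightarrow> _)"
    "order_on (sl2 :: ('k ^ 2 ^ 2) set) phiS 3"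
    "lie_aut (UNIV :: 'k set) sl2 (tauS :: 'k ^ 2 ^ 2 \<Rightarrow> _)"
    "order_on (sl2 :: ('k ^ 2 ^ 2) set) tauS 2"
proof -
  note two = assms
  have "bij_betw phiS (sl2 :: ('k^2^2) set) sl2"
    by (rule bij_betw_if_funpow_id[where n = 2]) (simp_all add: phiS_tauS_in_sl2 phiS_tauS_funpow[OF two] eval_nat_numeral)
  moreover have "sl2_triple ym zm (xm :: 'k^2^2)"
    using sl2_triple_basis unfolding sl2_triple_def by blast
  ultimately show "lie_aut (UNIV :: 'k set) sl2 (phiS :: 'k ^ 2 ^ 2 \<Rightarrow> _)"
    unfolding phiS_def by (rule lie_aut_lin3[OF two, rotated])
  have "bij_betw tauS (sl2 :: ('k^2^2) set) sl2"
    by (rule bij_betw_if_funpow_id[where n = 1]) (simp_all add: phiS_tauS_in_sl2 phiS_tauS_funpow[OF two])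
  moreover have "sl2_triple (- xm) (- zm) (- ym :: 'k^2^2)"
    by (simp add: sl2_triple_def mat_eq_iff brk_nth xm_def ym_def zm_def)
  ultimately show "lie_aut (UNIV :: 'k set) sl2 (tauS :: 'k ^ 2 ^ 2 \<Rightarrow> _)"
    unfolding tauS_def by (rule lie_aut_lin3[OF two, rotated])
  have xs: "(xm :: 'k^2^2) \<in> sl2" "(ym :: 'k^2^2) \<in> sl2"
    by (simp_all add: sl2_def)
  show "order_on (sl2 :: ('k ^ 2 ^ 2) set) phiS 3"
    unfolding order_on_def less_3_cases using xs
    by (auto simp: phiS_tauS_funpow[OF two] phiS_tauS_basis[OF two] basis_neq[OF two] eval_nat_numeral
        intro!: bexI[where x = xm])
  have "- zm \<noteq> (ym :: 'k^2^2)"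
    using basis_neq(3)[OF two] by (metis minus_minus)
  then show "order_on (sl2 :: ('k ^ 2 ^ 2) set) tauS 2"
    unfolding order_on_def using xs
    by (auto simp: phiS_tauS_funpow[OF two] phiS_tauS_basis[OF two] eval_nat_numeral less_Suc_eq
        intro!: bexI[where x = ym])
qed

section \<open>The algebra of regular functions and its substitutions\<close>

lemma emb_0 [simp]: "emb 0 = 0"
  and emb_1 [simp]: "emb 1 = 1"
  and emb_add [simp]: "emb (a + b) = emb a + emb b"
  and emb_mult [simp]: "emb (a * b) = emb a * emb b"
  and emb_minus [simp]: "emb (- a) = - emb a"
  by (simp_all add: emb_def one_pCons[symmetric] flip: to_fract_add to_fract_mult to_fract_uminus)

lemma emb_eq_0_iff [simp]: "emb a = 0 \<longleftrightarrow> a = 0"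
  by (simp add: emb_def)

lemma emb_2 [simp]: "emb 2 = 2"
  by (metis emb_1 emb_add one_add_one)

lemma T_neq [simp]: "(T :: 'k::field rf) \<noteq> 0" "(T :: 'k rf) \<noteq> 1"
  by (simp_all add: T_def one_pCons flip: to_fract_1)

lemma one_minus_T: "1 - T = to_fract [:1, -1:]"
  by (simp add: T_def one_pCons flip: to_fract_1 to_fract_diff)

lemma to_fract_pCons: "to_fract (pCons c p) = emb c + T * to_fract p"
  by (simp add: emb_def T_def flip: to_fract_add to_fract_mult)

lemma to_fract_power: "to_fract (p ^ n) = to_fract p ^ n"
  by (induction n) simp_all

definition peval :: "'k::field rf \<Rightarrow> 'k poly \<Rightarrow> 'k rf" where
  "peval s p = poly (map_poly emb p) s"

lemma peval_pCons [simp]: "peval s (pCons c p) = emb c + s * peval s p"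
  by (simp add: peval_def map_poly_pCons)

lemma peval_0 [simp]: "peval s 0 = 0"
  by (simp add: peval_def)

lemma peval_1 [simp]: "peval s 1 = 1"
  by (simp add: one_pCons)

lemma peval_add [simp]: "peval s (p + q) = peval s p + peval s q"
  by (induction p q rule: poly_induct2) (simp_all add: algebra_simps)

lemma peval_smult [simp]: "peval s (smult c p) = emb c * peval s p"
  by (induction p) (simp_all add: algebra_simps)

lemma peval_mult [simp]: "peval s (p * q) = peval s p * peval s q"
  by (induction p) (simp_all add: algebra_simps)

lemma peval_power [simp]: "peval s (p ^ n) = peval s p ^ n"
  by (induction n) simp_all

lemma peval_T: "peval T p = to_fract p"
  by (induction p) (simp_all add: to_fract_pCons)

lemma subst_rf_Fract:
  assumes "q \<noteq> 0" "peval s q \<noteq> 0"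
  shows "subst_rf s (Fract p q) = peval s p / peval s q"
  unfolding subst_rf_def peval_def[symmetric]
proof (rule some_equality)
  show "\<exists>p' q'. Fract p q = Fract p' q' \<and> q' \<noteq> 0 \<and> peval s q' \<noteq> 0
      \<and> peval s p / peval s q = peval s p' / peval s q'"
    using assms by blast
next
  fix v
  assume "\<exists>p' q'. Fract p q = Fract p' q' \<and> q' \<noteq> 0 \<and> peval s q' \<noteq> 0 \<and> v = peval s p' / peval s q'"
  then obtain p' q' where *: "Fract p q = Fract p' q'" "q' \<noteq> 0" "peval s q' \<noteq> 0"
    "v = peval s p' / peval s q'"
    by blast
  then have "p * q' = p' * q"
    using assms by (simp add: eq_fract)
  then have "peval s p * peval s q' = peval s p' * peval s q"
    by (metis peval_mult)
  then show "v = peval s p / peval s q"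
    unfolding *(4) using *(3) assms(2) by (simp add: frac_eq_eq)
qed

lemma Aset_cases:
  assumes "r \<in> Aset"
  obtains p a b where "r = to_fract p / (T ^ a * (1 - T) ^ b)"
  using assms unfolding Aset_def by blast

lemma subst_rf_Aset:
  assumes "s \<noteq> 0" "s \<noteq> 1"
  shows "subst_rf s (to_fract p / (T ^ a * (1 - T) ^ b)) = peval s p / (s ^ a * (1 - s) ^ b)"
proof -
  define q :: "'a poly" where "q = [:0, 1:] ^ a * [:1, -1:] ^ b"
  have "to_fract q = T ^ a * (1 - T) ^ b"
    by (simp add: q_def to_fract_power flip: one_minus_T T_def)
  then have "to_fract p / (T ^ a * (1 - T) ^ b) = Fract p q"
    by (simp add: Fract_conv_to_fract)
  moreover have "peval s q = s ^ a * (1 - s) ^ b"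
    by (simp add: q_def)
  moreover have "q \<noteq> 0"
    by (simp add: q_def)
  ultimately show ?thesis
    using assms by (simp add: subst_rf_Fract)
qed

lemma Aset_common:
  "to_fract p / (T ^ a * (1 - T) ^ b) =
    to_fract (p * ([:0, 1:] ^ c * [:1, -1:] ^ d)) / (T ^ (a + c) * (1 - T) ^ (b + d))"
  by (simp add: to_fract_power power_add flip: one_minus_T T_def)

lemma Aset_cases2:
  assumes "r \<in> Aset" "r' \<in> Aset"
  obtains p p' a b where "r = to_fract p / (T ^ a * (1 - T) ^ b)" "r' = to_fract p' / (T ^ a * (1 - T) ^ b)"
proof -
  obtain p a b p' a' b' where "r = to_fract p / (T ^ a * (1 - T) ^ b)"
      "r' = to_fract p' / (T ^ a' * (1 - T) ^ b')"
    using assms by (elim Aset_cases)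
  then have "r = to_fract (p * ([:0, 1:] ^ a' * [:1, -1:] ^ b')) / (T ^ (a + a') * (1 - T) ^ (b + b'))"
    "r' = to_fract (p' * ([:0, 1:] ^ a * [:1, -1:] ^ b)) / (T ^ (a + a') * (1 - T) ^ (b + b'))"
    using Aset_common[of p a b a' b'] Aset_common[of p' a' b' a b] by (simp_all only: add.commute)
  then show thesis
    by (rule that)
qed

lemma AsetI: "r = to_fract p / (T ^ a * (1 - T) ^ b) \<Longrightarrow> r \<in> Aset"
  unfolding Aset_def by blast

lemma Aset_add [intro]: "r \<in> Aset \<Longrightarrow> r' \<in> Aset \<Longrightarrow> r + r' \<in> Aset"
  by (erule (1) Aset_cases2, rule AsetI)
    (simp only: add_divide_distrib[symmetric] to_fract_add[symmetric])

lemma Aset_mult [intro]: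
  assumes "r \<in> Aset" "r' \<in> Aset"
  shows "r * r' \<in> Aset"
proof -
  obtain p a b p' a' b' where "r = to_fract p / (T ^ a * (1 - T) ^ b)"
      "r' = to_fract p' / (T ^ a' * (1 - T) ^ b')"
    using assms by (elim Aset_cases)
  then have "r * r' = to_fract (p * p') / (T ^ (a + a') * (1 - T) ^ (b + b'))"
    by (simp add: power_add)
  then show ?thesis
    by (rule AsetI)
qed

lemma Aset_to_fract [intro]: "to_fract p \<in> Aset"
  by (rule AsetI[where a = 0 and b = 0]) simp

lemma Aset_emb [intro, simp]: "emb c \<in> Aset"
  unfolding emb_def by blast

lemma Aset_0 [simp]: "0 \<in> Aset" and Aset_1 [simp]: "1 \<in> Aset" and Aset_T [simp]: "T \<in> Aset"
  using Aset_to_fract[of 0] Aset_to_fract[of 1] Aset_to_fract[of "[:0,1:]"] by (simp_all add: T_def)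

lemma Aset_2 [simp]: "2 \<in> Aset"
  by (metis Aset_emb emb_2)

lemma Aset_minus [intro]: "r \<in> Aset \<Longrightarrow> - r \<in> Aset"
  using Aset_mult[OF Aset_emb[of "-1"]] by simp

lemma Aset_diff [intro]: "r \<in> Aset \<Longrightarrow> r' \<in> Aset \<Longrightarrow> r - r' \<in> Aset"
  using Aset_add[OF _ Aset_minus] by simp

lemma Aset_inverses [simp]: "1 / T \<in> Aset" "1 / (1 - T) \<in> Aset"
  by (rule AsetI[where p = 1 and a = 1 and b = 0], simp)
    (rule AsetI[where p = 1 and a = 0 and b = 1], simp)

lemma Aset_power [intro]: "r \<in> Aset \<Longrightarrow> r ^ n \<in> Aset"
  by (induction n) auto

lemma Aset_half:
  assumes "(2::'k::field) \<noteq> 0" "r \<in> (Aset :: 'k rf set)"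
  shows "r / 2 \<in> Aset"
proof -
  have "emb (1/2::'k) * 2 = 1"
    using assms(1) by (simp flip: emb_2 emb_mult)
  moreover have "(2::'k rf) \<noteq> 0"
    using assms(1) by (simp flip: emb_2)
  ultimately have "r / 2 = emb (1/2) * r"
    by (simp add: field_simps)
  then show ?thesis
    using Aset_mult[OF Aset_emb assms(2)] by (simp only:)
qed

text \<open>The substitutions \<open>t \<mapsto> s\<close> that preserve \<open>\<A>\<close> are those with \<open>s\<close> and \<open>1 - s\<close> units of \<open>\<A>\<close>.\<close>
definition admissible :: "'k::field rf \<Rightarrow> bool" where
  "admissible s \<longleftrightarrow> s \<noteq> 0 \<and> s \<noteq> 1 \<and> s \<in> Aset \<and> 1 / s \<in> Aset \<and> 1 / (1 - s) \<in> Aset"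

lemma peval_Aset: "s \<in> Aset \<Longrightarrow> peval s p \<in> Aset"
  by (induction p) auto

lemma subst_rf_in_Aset:
  assumes "admissible s" "r \<in> Aset"
  shows "subst_rf s r \<in> Aset"
proof -
  obtain p a b where "r = to_fract p / (T ^ a * (1 - T) ^ b)"
    using assms(2) by (rule Aset_cases)
  then have "subst_rf s r = peval s p * ((1 / s) ^ a * (1 / (1 - s)) ^ b)"
    using assms(1) by (simp add: subst_rf_Aset admissible_def power_one_over)
  then show ?thesis
    using assms(1) peval_Aset unfolding admissible_def by auto
qed

lemma subst_rf_add:
  assumes "admissible s" "r \<in> Aset" "r' \<in> Aset"
  shows "subst_rf s (r + r') = subst_rf s r + subst_rf s r'"
proof -
  obtain p p' a b where r: "r = to_fract p / (T ^ a * (1 - T) ^ b)" "r' = to_fract p' / (T ^ a * (1 - T) ^ b)"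
    using assms(2,3) by (rule Aset_cases2)
  then have "r + r' = to_fract (p + p') / (T ^ a * (1 - T) ^ b)"
    by (simp add: add_divide_distrib)
  then show ?thesis
    using assms(1) r by (simp add: subst_rf_Aset admissible_def add_divide_distrib del: to_fract_add)
qed

lemma subst_rf_mult:
  assumes "admissible s" "r \<in> Aset" "r' \<in> Aset"
  shows "subst_rf s (r * r') = subst_rf s r * subst_rf s r'"
proof -
  obtain p a b p' a' b' where r: "r = to_fract p / (T ^ a * (1 - T) ^ b)"
      "r' = to_fract p' / (T ^ a' * (1 - T) ^ b')"
    using assms(2,3) by (elim Aset_cases)
  then have rr: "r * r' = to_fract (p * p') / (T ^ (a + a') * (1 - T) ^ (b + b'))"
    by (simp add: power_add)
  show ?thesis
    using assms(1) unfolding rr unfolding r admissible_def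
    by (simp add: subst_rf_Aset del: to_fract_mult) (simp add: power_add)
qed

lemma subst_rf_to_fract: "admissible s \<Longrightarrow> subst_rf s (to_fract p) = peval s p"
  using subst_rf_Aset[of s p 0 0] by (simp add: admissible_def)

lemma subst_rf_emb [simp]: "admissible s \<Longrightarrow> subst_rf s (emb c) = emb c"
  unfolding emb_def by (simp add: subst_rf_to_fract) (simp add: emb_def)

lemma subst_rf_T [simp]: "admissible s \<Longrightarrow> subst_rf s T = s"
  unfolding T_def by (simp add: subst_rf_to_fract)

lemma subst_rf_0 [simp]: "admissible s \<Longrightarrow> subst_rf s 0 = 0"
  and subst_rf_1 [simp]: "admissible s \<Longrightarrow> subst_rf s 1 = 1"
  and subst_rf_2 [simp]: "admissible s \<Longrightarrow> subst_rf s 2 = 2"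
  using subst_rf_emb[of s 0] subst_rf_emb[of s 1] subst_rf_emb[of s 2] by simp_all

lemma subst_rf_minus: "admissible s \<Longrightarrow> r \<in> Aset \<Longrightarrow> subst_rf s (- r) = - subst_rf s r"
  using subst_rf_mult[of s "emb (-1)" r] subst_rf_emb[of s "-1"] Aset_emb[of "-1"] by simp

lemma subst_rf_diff:
  "admissible s \<Longrightarrow> r \<in> Aset \<Longrightarrow> r' \<in> Aset \<Longrightarrow> subst_rf s (r - r') = subst_rf s r - subst_rf s r'"
  using subst_rf_add[of s r "- r'"] subst_rf_minus[of s r'] by (simp add: Aset_minus)

lemma subst_rf_inverse:
  assumes "admissible s" "r \<in> Aset" "1 / r \<in> Aset" "r \<noteq> 0"
  shows "subst_rf s (1 / r) = 1 / subst_rf s r"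
proof -
  have "subst_rf s (1 / r) * subst_rf s r = 1"
    using assms by (simp flip: subst_rf_mult)
  then show ?thesis
    by (metis mult_zero_right nonzero_eq_divide_eq zero_neq_one)
qed

lemma subst_rf_T_id: "r \<in> Aset \<Longrightarrow> subst_rf T r = r"
  by (erule Aset_cases) (simp add: subst_rf_Aset T_neq peval_T)

lemma subst_rf_power: "admissible s \<Longrightarrow> r \<in> Aset \<Longrightarrow> subst_rf s (r ^ n) = subst_rf s r ^ n"
  by (induction n) (simp_all add: subst_rf_mult Aset_power)

lemma subst_rf_peval:
  "admissible s \<Longrightarrow> s' \<in> Aset \<Longrightarrow> subst_rf s (peval s' p) = peval (subst_rf s s') p"
  by (induction p) (simp_all add: subst_rf_add subst_rf_mult peval_Aset Aset_mult)

lemma subst_rf_subst_rf: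
  assumes "admissible s" "admissible s'" "subst_rf s s' = s''" "r \<in> Aset"
  shows "subst_rf s (subst_rf s' r) = subst_rf s'' r"
proof -
  obtain p a b where r: "r = to_fract p / (T ^ a * (1 - T) ^ b)"
    using assms(4) by (rule Aset_cases)
  have A: "s' \<in> Aset" "1 / s' \<in> Aset" "1 / (1 - s') \<in> Aset" "1 - s' \<in> Aset" "s' \<noteq> 0" "1 - s' \<noteq> 0"
    using assms(2) unfolding admissible_def by auto
  have i: "subst_rf s (1 / s') = 1 / s''" "subst_rf s (1 / (1 - s')) = 1 / (1 - s'')"
    using assms(1,3) A by (simp_all add: subst_rf_inverse subst_rf_diff)
  have "s'' \<noteq> 0" "s'' \<noteq> 1"
  proof -
    have "subst_rf s (s' * (1 / s')) = s'' * (1 / s'')"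
      "subst_rf s ((1 - s') * (1 / (1 - s'))) = (1 - s'') * (1 / (1 - s''))"
      using assms(1,3) A i by (simp_all only: subst_rf_mult subst_rf_diff subst_rf_1 Aset_1)
    then show "s'' \<noteq> 0" "s'' \<noteq> 1"
      using assms(1) A by auto
  qed
  have "subst_rf s' r = peval s' p * ((1 / s') ^ a * (1 / (1 - s')) ^ b)"
    using assms(2) r by (simp add: subst_rf_Aset admissible_def power_one_over)
  then have "subst_rf s (subst_rf s' r) = peval s'' p * ((1 / s'') ^ a * (1 / (1 - s'')) ^ b)"
    using assms(1,3) A
    by (simp add: subst_rf_mult subst_rf_power subst_rf_peval peval_Aset Aset_mult Aset_power i)
  then show ?thesis
    using r \<open>s'' \<noteq> 0\<close> \<open>s'' \<noteq> 1\<close> by (simp add: subst_rf_Aset power_one_over)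
qed

lemma alg_aut_A_subst_rf:
  assumes "admissible s" "bij_betw (subst_rf s) Aset Aset"
  shows "alg_aut_A (subst_rf s)"
  using assms by (simp add: alg_aut_A_def subst_rf_add subst_rf_mult)

lemma t1_in_Aset: "t1 \<in> Aset" and t2_in_Aset: "t2 \<in> Aset"
  unfolding t1_def t2_def by auto

lemma admissible_t1: "admissible (t1 :: 'k::field rf)"
proof -
  have "1 / (t1 :: 'k rf) = - (T * (1 / (1 - T)))" "1 / (1 - t1) = (T :: 'k rf)"
    using T_neq by (simp_all add: t1_def field_simps)
  moreover have "t1 \<noteq> (0 :: 'k rf)" "t1 \<noteq> (1 :: 'k rf)"
    using T_neq by (auto simp: t1_def)
  ultimately show ?thesis
    using Aset_minus[OF Aset_mult[OF Aset_T Aset_inverses(2)]]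
    by (simp add: admissible_def t1_in_Aset)
qed

lemma admissible_one_minus_T: "admissible (1 - T)"
  using T_neq by (auto simp: admissible_def)

lemma subst_t1_t1: "subst_rf t1 t1 = t2"
proof -
  have "subst_rf t1 t1 = 1 - 1 / t1"
    by (subst (2) t1_def) (simp add: subst_rf_diff subst_rf_inverse admissible_t1 T_neq)
  also have "\<dots> = t2"
    using T_neq by (simp add: t1_def t2_def field_simps)
  finally show ?thesis .
qed

lemma subst_t1_t2: "subst_rf t1 t2 = T"
proof -
  have "subst_rf t1 t2 = 1 / (1 - t1)"
    using T_neq unfolding t2_def
    by (simp add: subst_rf_diff subst_rf_inverse admissible_t1 Aset_diff)
  also have "\<dots> = T"
    using T_neq by (simp add: t1_def)
  finally show ?thesis .
qed

lemma subst_one_minus_T: "subst_rf (1 - T) (1 - T) = T"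
  by (simp add: subst_rf_diff admissible_one_minus_T)

lemma phiA_phiA: "r \<in> Aset \<Longrightarrow> phiA (phiA r) = subst_rf t2 r"
  unfolding phiA_def by (simp add: subst_rf_subst_rf[OF admissible_t1 admissible_t1 subst_t1_t1])

lemma admissible_t2: "admissible (t2 :: 'k::field rf)"
proof -
  have "1 / (t2 :: 'k rf) = 1 - T" "1 / (1 - t2) = (1 - 1 / T :: 'k rf)"
    using T_neq by (simp_all add: t2_def field_simps)
  moreover have "t2 \<noteq> (0 :: 'k rf)" "t2 \<noteq> (1 :: 'k rf)"
    using T_neq by (auto simp: t2_def)
  ultimately show ?thesis
    by (auto simp: admissible_def t2_in_Aset)
qed

lemma phiA_cubed: "r \<in> Aset \<Longrightarrow> phiA (phiA (phiA r)) = r"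
  by (simp add: phiA_phiA)
    (simp add: phiA_def subst_rf_subst_rf[OF admissible_t1 admissible_t2 subst_t1_t2] subst_rf_T_id)

lemma tauA_squared: "r \<in> Aset \<Longrightarrow> tauA (tauA r) = r"
  unfolding tauA_def
  by (simp add: subst_rf_subst_rf[OF admissible_one_minus_T admissible_one_minus_T subst_one_minus_T]
      subst_rf_T_id)

lemma t1_neq_T: "t1 \<noteq> T" and t2_neq_T: "t2 \<noteq> T" and one_minus_T_neq_T: "1 - T \<noteq> T"
proof -
  have "T - 1 \<noteq> T * T" "1 \<noteq> T * (1 - T)"
    unfolding T_def by (simp_all add: one_pCons flip: to_fract_1 to_fract_diff to_fract_mult)
  then show "t1 \<noteq> T" "t2 \<noteq> T"
    using T_neq by (auto simp: t1_def t2_def field_simps)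
  show "1 - T \<noteq> T"
    unfolding one_minus_T by (simp add: T_def)
qed

lemma algebra_automorphisms:
  "alg_aut_A (phiA :: 'k::field rf \<Rightarrow> _)" "order_on (Aset :: 'k rf set) phiA 3"
  "alg_aut_A (tauA :: 'k rf \<Rightarrow> _)" "order_on (Aset :: 'k rf set) tauA 2"
proof -
  have A: "phiA r \<in> Aset" "tauA r \<in> Aset" if "r \<in> Aset" for r :: "'k rf"
    using that by (simp_all add: phiA_def tauA_def subst_rf_in_Aset admissible_t1 admissible_one_minus_T)
  have "bij_betw phiA (Aset :: 'k rf set) Aset"
    by (rule bij_betw_if_funpow_id[where n = 2]) (simp_all add: A phiA_cubed eval_nat_numeral)
  then show "alg_aut_A (phiA :: 'k rf \<Rightarrow> _)"
    unfolding phiA_def by (rule alg_aut_A_subst_rf[OF admissible_t1])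
  have "bij_betw tauA (Aset :: 'k rf set) Aset"
    by (rule bij_betw_if_funpow_id[where n = 1]) (simp_all add: A tauA_squared)
  then show "alg_aut_A (tauA :: 'k rf \<Rightarrow> _)"
    unfolding tauA_def by (rule alg_aut_A_subst_rf[OF admissible_one_minus_T])
  have "phiA T = (t1 :: 'k rf)" "phiA (phiA T) = (t2 :: 'k rf)" "tauA T = (1 - T :: 'k rf)"
    unfolding phiA_phiA[OF Aset_T]
    by (simp_all add: phiA_def tauA_def admissible_t1 admissible_t2 admissible_one_minus_T)
  then have "phiA T \<noteq> (T :: 'k rf)" "phiA (phiA T) \<noteq> (T :: 'k rf)" "tauA T \<noteq> (T :: 'k rf)"
    by (simp_all add: t1_neq_T t2_neq_T one_minus_T_neq_T)
  then show "order_on (Aset :: 'k rf set) phiA 3" "order_on (Aset :: 'k rf set) tauA 2"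
    unfolding order_on_def less_3_cases
    by (auto simp: phiA_cubed tauA_squared eval_nat_numeral less_Suc_eq intro!: bexI[where x = T])
qed

section \<open>Four points on the projective line\<close>

definition pdet :: "'f::field \<times> 'f \<Rightarrow> 'f \<times> 'f \<Rightarrow> 'f" where
  "pdet a b = fst a * snd b - fst b * snd a"

text \<open>The traceless matrix with eigenvector \<open>a\<close> for \<open>-1\<close> and eigenvector \<open>b\<close> for \<open>1\<close>.\<close>
definition eig :: "'f::field \<times> 'f \<Rightarrow> 'f \<times> 'f \<Rightarrow> 'f ^ 2 ^ 2" where
  "eig a b = smat (1 / pdet a b)
     (mat2 (- (fst a * snd b + fst b * snd a)) (2 * fst a * fst b)
       (- 2 * snd a * snd b) (fst a * snd b + fst b * snd a))"

definition cratio :: "'f::field \<times> 'f \<Rightarrow> 'f \<times> 'f \<Rightarrow> 'f \<times> 'f \<Rightarrow> 'f \<times> 'f \<Rightarrow> 'f" where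
  "cratio a b c d = (pdet a b * pdet c d) / (pdet a d * pdet c b)"

lemma pdet_swap: "pdet b a = - pdet a b"
  by (simp add: pdet_def)

lemma eig_swap: "eig b a = - eig a b"
proof -
  have "1 / pdet b a = - (1 / pdet a b)"
    unfolding pdet_swap[of b a] by simp
  then show ?thesis
    unfolding eig_def by (simp add: mat_eq_iff algebra_simps)
qed

lemma smat_pdet_eig:
  assumes "pdet u v \<noteq> 0"
  shows "smat (pdet u v) (eig u v) =
      mat2 (- (fst u * snd v + fst v * snd u)) (2 * fst u * fst v)
       (- 2 * snd u * snd v) (fst u * snd v + fst v * snd u)"
  using assms by (simp add: eig_def smat_smat)

lemma smat_cancel: "c \<noteq> 0 \<Longrightarrow> smat c M = smat c N \<Longrightarrow> M = N" for c :: "'f::field"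
  by (simp add: mat_eq_iff)

lemma plucker: "pdet a b * pdet c d = pdet a d * pdet c b + pdet a c * pdet b d"
  unfolding pdet_def by algebra

lemma eig_brk:
  assumes "pdet a b \<noteq> 0" "pdet b c \<noteq> 0"
  shows "brk (eig a b) (eig b c) = smat 2 (eig a b + eig b c)"
proof -
  have "smat (pdet a b * pdet b c) (brk (eig a b) (eig b c)) =
      brk (smat (pdet a b) (eig a b)) (smat (pdet b c) (eig b c))"
    by (simp add: brk_bilinear smat_smat mult.commute)
  also have "\<dots> = smat 2 (smat (pdet b c) (smat (pdet a b) (eig a b)) +
      smat (pdet a b) (smat (pdet b c) (eig b c)))"
    unfolding assms[THEN smat_pdet_eig] unfolding mat_eq_iff brk_nth pdet_def
    by (simp add: algebra_simps)
  also have "\<dots> = smat (pdet a b * pdet b c) (smat 2 (eig a b + eig b c))"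
    by (simp add: smat_smat smat_add_right mult_ac)
  finally show ?thesis
    by (rule smat_cancel[rotated]) (use assms in simp)
qed

lemma eig_cratio:
  assumes "pdet a d \<noteq> 0" "pdet c b \<noteq> 0" "pdet c d \<noteq> 0" "pdet d b \<noteq> 0"
  shows "eig a d = smat (cratio a b c d) (eig c d) + smat (cratio a b c d - 1) (eig d b)"
proof -
  have r: "cratio a b c d - 1 = pdet a c * pdet b d / (pdet a d * pdet c b)"
    using assms plucker[of a b c d] by (simp add: cratio_def field_simps)
  obtain D where D: "D = pdet a d * pdet c b"
    by blast
  then have "D \<noteq> 0"
    using assms by simp
  have "smat (cratio a b c d) (eig c d) = smat (1 / D) (smat (pdet a b) (smat (pdet c d) (eig c d)))"
    "smat (cratio a b c d - 1) (eig d b) = smat (1 / D) (smat (- pdet a c) (smat (pdet d b) (eig d b)))"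
    "eig a d = smat (1 / D) (smat (pdet c b) (smat (pdet a d) (eig a d)))"
    using \<open>D \<noteq> 0\<close> unfolding r by (simp_all add: smat_smat cratio_def pdet_swap[of b d] D mult_ac)
  moreover have "smat (pdet c b) (smat (pdet a d) (eig a d)) =
      smat (pdet a b) (smat (pdet c d) (eig c d)) + smat (- pdet a c) (smat (pdet d b) (eig d b))"
    unfolding assms[THEN smat_pdet_eig] unfolding mat_eq_iff pdet_def by (simp add: algebra_simps)
  ultimately show ?thesis
    by (metis smat_add_right)
qed

context
  fixes a b c d :: "'f::field \<times> 'f"
  assumes nz: "pdet a b \<noteq> 0" "pdet a c \<noteq> 0" "pdet a d \<noteq> 0" "pdet b c \<noteq> 0" "pdet b d \<noteq> 0" "pdet c d \<noteq> 0"
begin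

lemma one_minus_cratio: "1 - cratio a b c d = cratio a c b d"
proof -
  have "pdet c b \<noteq> 0"
    using nz pdet_swap[of c b] by simp
  then show ?thesis
    using nz plucker[of a b c d] by (simp add: cratio_def pdet_swap[of b c] field_simps)
qed

lemma cratio_rotate:
  "cratio a c d b = 1 - 1 / cratio a b c d" "cratio a d b c = 1 / (1 - cratio a b c d)"
proof -
  have "pdet c b = - pdet b c" "pdet d b = - pdet b d" "pdet d c = - pdet c d"
    by (rule pdet_swap)+
  note s = this
  show "cratio a c d b = 1 - 1 / cratio a b c d"
    using nz plucker[of a b c d] by (simp add: cratio_def s field_simps)
  show "cratio a d b c = 1 / (1 - cratio a b c d)"
    unfolding one_minus_cratio using nz by (simp add: cratio_def s)
qed

end

lemma eig_add_neq_0: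
  assumes "pdet a b \<noteq> 0" "pdet b c \<noteq> 0" "pdet a c \<noteq> 0" "(2::'f::field) \<noteq> 0"
  shows "eig a b + eig b c \<noteq> (0 :: 'f ^ 2 ^ 2)"
proof
  assume z: "eig a b + eig b c = 0"
  have "smat (pdet b c) (smat (pdet a b) (eig a b)) + smat (pdet a b) (smat (pdet b c) (eig b c)) =
      smat (pdet a b * pdet b c) (eig a b + eig b c)"
    by (simp add: smat_smat smat_add_right mult.commute)
  also have "\<dots> = 0"
    by (simp add: z)
  finally have "2 * pdet a c * (fst b * fst b) = 0" "2 * pdet a c * (snd b * snd b) = 0"
    unfolding smat_pdet_eig[OF assms(1)] smat_pdet_eig[OF assms(2)] unfolding mat_eq_iff pdet_def by (simp_all, algebra+)
  then have "fst b = 0" "snd b = 0"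
    using assms(3,4) by auto
  then show False
    using assms(1) by (simp add: pdet_def)
qed

lemma pdet_eq_0_if_eig_eq:
  assumes "eig a b = eig c d" "pdet a b \<noteq> 0" "pdet c d \<noteq> 0" "(2::'f::field) \<noteq> 0"
  shows "pdet a c = (0 :: 'f)"
proof -
  have "smat (pdet c d) (smat (pdet a b) (eig a b)) = smat (pdet a b) (smat (pdet c d) (eig c d))"
    by (simp add: smat_smat assms(1) mult.commute)
  then have "2 * pdet a b * pdet a c * fst d = 0" "2 * pdet a b * pdet a c * snd d = 0"
    unfolding smat_pdet_eig[OF assms(2)] smat_pdet_eig[OF assms(3)] unfolding mat_eq_iff pdet_def by (simp_all, algebra+)
  then have "pdet a c \<noteq> 0 \<Longrightarrow> fst d = 0 \<and> snd d = 0"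
    using assms(2,4) by auto
  moreover have "\<not> (fst d = 0 \<and> snd d = 0)"
    using assms(3) by (auto simp: pdet_def)
  ultimately show ?thesis
    by blast
qed

section \<open>The action of the symmetric group\<close>

definition pt :: "nat \<Rightarrow> 'k::field rf \<times> 'k rf" where
  "pt i = (if i = 1 then (1, 0) else if i = 2 then (1, 1) else if i = 3 then (0, 1) else (1, T))"

definition edge :: "nat \<Rightarrow> nat \<Rightarrow> 'k::field rf ^ 2 ^ 2" where
  "edge i j = eig (pt i) (pt j)"

definition ratio :: "(nat \<Rightarrow> nat) \<Rightarrow> 'k::field rf" where
  "ratio \<sigma> = cratio (pt (\<sigma> 0)) (pt (\<sigma> 1)) (pt (\<sigma> 2)) (pt (\<sigma> 3))"

definition rho :: "(nat \<Rightarrow> nat) \<Rightarrow> 'k::field rf ^ 2 ^ 2 \<Rightarrow> 'k rf ^ 2 ^ 2" where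
  "rho \<sigma> M = smat (subst_rf (ratio \<sigma>) (cx M)) (edge (\<sigma> 1) (\<sigma> 2))
     + smat (subst_rf (ratio \<sigma>) (cy M)) (edge (\<sigma> 2) (\<sigma> 3))
     + smat (subst_rf (ratio \<sigma>) (cz M)) (edge (\<sigma> 3) (\<sigma> 1))"

lemma atMost_3_cases: "i \<in> {0..3} \<longleftrightarrow> i = 0 \<or> i = 1 \<or> i = 2 \<or> i = (3::nat)"
  by auto

lemma pdet_pt_unit:
  assumes "i \<in> {0..3}" "j \<in> {0..3}" "i \<noteq> j"
  shows "pdet (pt i) (pt j) \<noteq> (0 :: 'k::field rf)" "pdet (pt i) (pt j) \<in> (Aset :: 'k rf set)"
    "1 / pdet (pt i) (pt j) \<in> (Aset :: 'k rf set)"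
proof -
  have m: "- 1 \<in> (Aset :: 'k rf set)" "- T \<in> (Aset :: 'k rf set)" "1 - T \<in> (Aset :: 'k rf set)"
    "T - 1 \<in> (Aset :: 'k rf set)" "- (1 / T) \<in> (Aset :: 'k rf set)"
    by (simp_all add: Aset_minus Aset_diff)
  have "1 / (T - 1) = - (1 / (1 - T :: 'k rf))"
    by (metis divide_minus_right minus_diff_eq)
  then have "1 / (T - 1) \<in> (Aset :: 'k rf set)"
    using Aset_minus[OF Aset_inverses(2)] by simp
  with m show "pdet (pt i) (pt j) \<noteq> (0 :: 'k rf)" "pdet (pt i) (pt j) \<in> (Aset :: 'k rf set)"
    "1 / pdet (pt i) (pt j) \<in> (Aset :: 'k rf set)"
    using assms unfolding atMost_3_cases by (elim disjE; simp add: pt_def pdet_def)+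
qed

lemma S4_in:
  assumes "\<sigma> \<in> S4" "i \<in> {0..3}"
  shows "\<sigma> i \<in> {0..3}"
proof -
  have "{0, 1, 2, 3} = {0..3::nat}"
    by auto
  then have "\<sigma> permutes {0..3}"
    using assms(1) unfolding S4_def by simp
  then show ?thesis
    using assms(2) by (simp only: permutes_in_image)
qed

lemma S4_eq_iff: "\<sigma> \<in> S4 \<Longrightarrow> \<sigma> i = \<sigma> j \<longleftrightarrow> i = j"
  unfolding S4_def using permutes_inj by (metis injD mem_Collect_eq)

lemma S4_comp: "\<sigma> \<in> S4 \<Longrightarrow> \<pi> \<in> S4 \<Longrightarrow> \<sigma> \<circ> \<pi> \<in> S4"
  and S4_inv: "\<sigma> \<in> S4 \<Longrightarrow> inv \<sigma> \<in> S4"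
  unfolding S4_def by (simp_all add: permutes_compose permutes_inv)

lemma pdet_perm:
  assumes "\<sigma> \<in> S4" "i \<in> {0..3}" "j \<in> {0..3}" "i \<noteq> j"
  shows "pdet (pt (\<sigma> i)) (pt (\<sigma> j)) \<noteq> (0 :: 'k::field rf)" "pdet (pt (\<sigma> i)) (pt (\<sigma> j)) \<in> (Aset :: 'k rf set)"
    "1 / pdet (pt (\<sigma> i)) (pt (\<sigma> j)) \<in> (Aset :: 'k rf set)"
  using assms by (simp_all add: pdet_pt_unit S4_in S4_eq_iff del: atLeastAtMost_iff)

lemma admissible_ratio:
  assumes "\<sigma> \<in> S4"
  shows "admissible (ratio \<sigma> :: 'k::field rf)"
proof -
  let ?p = "\<lambda>i. pt (\<sigma> i) :: 'k rf \<times> 'k rf"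
  note u = pdet_perm[OF assms]
  have unit: "cratio (?p 0) (?p i) (?p j) (?p 3) \<noteq> 0 \<and> cratio (?p 0) (?p i) (?p j) (?p 3) \<in> Aset \<and>
      1 / cratio (?p 0) (?p i) (?p j) (?p 3) \<in> Aset"
    if "i \<in> {1, 2}" "j \<in> {1, 2}" "i \<noteq> j" for i j
  proof -
    have ij: "i \<in> {0..3}" "j \<in> {0..3}" "i \<noteq> 0" "i \<noteq> 3" "j \<noteq> 0" "j \<noteq> 3"
      using that by auto
    have "cratio (?p 0) (?p i) (?p j) (?p 3) = pdet (?p 0) (?p i) * pdet (?p j) (?p 3) *
        ((1 / pdet (?p 0) (?p 3)) * (1 / pdet (?p j) (?p i)))"
      "1 / cratio (?p 0) (?p i) (?p j) (?p 3) = (1 / pdet (?p 0) (?p i)) * (1 / pdet (?p j) (?p 3)) *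
        (pdet (?p 0) (?p 3) * pdet (?p j) (?p i))"
      by (simp_all add: cratio_def)
    moreover have "cratio (?p 0) (?p i) (?p j) (?p 3) \<noteq> 0"
    proof -
      have "pdet (?p 0) (?p i) \<noteq> 0" "pdet (?p j) (?p 3) \<noteq> 0" "pdet (?p 0) (?p 3) \<noteq> 0" "pdet (?p j) (?p i) \<noteq> 0"
        by (rule u(1); use that ij in simp)+
      then show ?thesis
        by (simp add: cratio_def)
    qed
    ultimately show ?thesis
      using that ij by (simp only:) (intro conjI Aset_mult u; simp)
  qed
  have "1 - cratio (?p 0) (?p 1) (?p 2) (?p 3) = cratio (?p 0) (?p 2) (?p 1) (?p 3)"
    by (rule one_minus_cratio; rule u; simp)
  then show ?thesis
    using unit[of 1 2] unit[of 2 1] unfolding admissible_def ratio_def by auto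
qed

lemma gset_trace0: "M \<in> gset \<Longrightarrow> trace0 M"
  by (simp add: gset_def)

lemma gset_add: "M \<in> gset \<Longrightarrow> N \<in> gset \<Longrightarrow> M + N \<in> gset"
  and gset_smat: "a \<in> Aset \<Longrightarrow> M \<in> gset \<Longrightarrow> smat a M \<in> gset"
  and gset_0: "0 \<in> gset"
  unfolding gset_def by (auto simp: trace0_add trace0_smat) (simp add: trace0_def)

lemma gset_brk: "M \<in> gset \<Longrightarrow> N \<in> gset \<Longrightarrow> brk M N \<in> gset"
  unfolding gset_def brk_nth mem_Collect_eq
  by (intro conjI allI trace0_brk Aset_diff Aset_add Aset_mult) simp_all

lemma gset_minus: "M \<in> gset \<Longrightarrow> - M \<in> gset"
  unfolding gset_def by auto

lemma gset_eig:
  assumes "fst a \<in> Aset" "snd a \<in> Aset" "fst b \<in> Aset" "snd b \<in> Aset" "1 / pdet a b \<in> Aset"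
  shows "eig a b \<in> gset"
proof -
  have "- (fst a * snd b + fst b * snd a) \<in> Aset" "2 * fst a * fst b \<in> Aset"
    "- 2 * snd a * snd b \<in> Aset" "fst a * snd b + fst b * snd a \<in> Aset"
    using assms Aset_minus[OF Aset_2] by (auto simp only: intro!: Aset_minus Aset_mult Aset_add Aset_2)
  then have "mat2 (- (fst a * snd b + fst b * snd a)) (2 * fst a * fst b)
       (- 2 * snd a * snd b) (fst a * snd b + fst b * snd a) \<in> gset"
    unfolding gset_def by (simp add: forall_2 trace0_iff)
  then show ?thesis
    unfolding eig_def using assms(5) by (rule gset_smat[rotated])
qed

lemma pt_Aset: "fst (pt i) \<in> Aset" "snd (pt i) \<in> Aset"
  by (simp_all add: pt_def)

lemma edge_gset: "i \<in> {0..3} \<Longrightarrow> j \<in> {0..3} \<Longrightarrow> i \<noteq> j \<Longrightarrow> edge i j \<in> gset"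
  unfolding edge_def by (rule gset_eig[OF pt_Aset pt_Aset pdet_pt_unit(3)])

lemma edge_swap: "edge j i = - edge i j"
  unfolding edge_def by (rule eig_swap)

lemma XYZ_eq: "X = xm" "Y = ym" "Z = zm"
  by (simp_all add: X_def Y_def Z_def lift_def mat_eq_iff xm_def ym_def zm_def)

lemma edge_basis: "edge 1 2 = xm" "edge 2 3 = ym" "edge 3 1 = zm"
  by (simp_all add: edge_def eig_def pt_def pdet_def mat_eq_iff xm_def ym_def zm_def)

lemma edge_0:
  "edge 0 3 = smat T ym + smat (T - 1) zm"
  "edge 0 1 = smat t1 zm + smat (t1 - 1) xm"
  "edge 0 2 = smat t2 xm + smat (t2 - 1) ym"
  by (simp_all add: edge_def eig_def pt_def pdet_def mat_eq_iff xm_def ym_def zm_def t1_def t2_def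
      divide_simps)

context
  assumes two: "(2::'k::field) \<noteq> 0"
begin

lemma two_rf: "(2::'k rf) \<noteq> 0"
  using two by (simp flip: emb_2)

lemma coords_Aset:
  assumes "M \<in> (gset :: ('k rf ^ 2 ^ 2) set)"
  shows "cx M \<in> Aset" "cy M \<in> Aset" "cz M \<in> Aset"
  using assms unfolding gset_def cx_def cy_def cz_def
  by (auto intro!: Aset_half[OF two] Aset_minus Aset_diff Aset_add)

lemma rho_semilinear:
  assumes "\<sigma> \<in> S4" "a \<in> Aset" "M \<in> gset" "N \<in> (gset :: ('k rf ^ 2 ^ 2) set)"
  shows "rho \<sigma> (smat a M + N) = smat (subst_rf (ratio \<sigma>) a) (rho \<sigma> M) + rho \<sigma> N"
  using assms admissible_ratio[OF assms(1), where 'k = 'k]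
  by (simp add: rho_def coords_Aset subst_rf_add subst_rf_mult Aset_mult smat_add_left smat_add_right smat_smat)

lemma rho_0:
  assumes "\<sigma> \<in> S4"
  shows "rho \<sigma> (0 :: 'k rf ^ 2 ^ 2) = 0"
proof -
  have "rho \<sigma> (smat 1 0 + (0 :: 'k rf ^ 2 ^ 2)) = smat 1 (rho \<sigma> 0) + rho \<sigma> 0"
    using rho_semilinear[OF assms, of 1 0 0] admissible_ratio[OF assms, where 'k = 'k]
    by (simp add: gset_0)
  then show ?thesis
    by simp
qed

lemma rho_smat:
  assumes "\<sigma> \<in> S4" "a \<in> Aset" "M \<in> (gset :: ('k rf ^ 2 ^ 2) set)"
  shows "rho \<sigma> (smat a M) = smat (subst_rf (ratio \<sigma>) a) (rho \<sigma> M)"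
  using rho_semilinear[OF assms gset_0] by (simp add: rho_0 assms(1))

lemma rho_add:
  assumes "\<sigma> \<in> S4" "M \<in> gset" "N \<in> (gset :: ('k rf ^ 2 ^ 2) set)"
  shows "rho \<sigma> (M + N) = rho \<sigma> M + rho \<sigma> N"
  using rho_semilinear[OF assms(1) Aset_1 assms(2,3)] admissible_ratio[OF assms(1), where 'k = 'k] by simp

lemma rho_minus:
  assumes "\<sigma> \<in> S4" "M \<in> (gset :: ('k rf ^ 2 ^ 2) set)"
  shows "rho \<sigma> (- M) = - rho \<sigma> M"
  using rho_add[OF assms(1) assms(2) gset_minus[OF assms(2)]]
  by (simp add: rho_0 assms(1) add_eq_0_iff)

lemma gset_basis: "xm \<in> (gset :: ('k rf ^ 2 ^ 2) set)" "ym \<in> (gset :: ('k rf ^ 2 ^ 2) set)"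
    "zm \<in> (gset :: ('k rf ^ 2 ^ 2) set)"
  using edge_gset[of 1 2] edge_gset[of 2 3] edge_gset[of 3 1] by (simp_all add: edge_basis[symmetric])

lemma rho_basis:
  assumes "\<sigma> \<in> S4"
  shows "rho \<sigma> xm = (edge (\<sigma> 1) (\<sigma> 2) :: 'k rf ^ 2 ^ 2)" "rho \<sigma> ym = (edge (\<sigma> 2) (\<sigma> 3) :: 'k rf ^ 2 ^ 2)"
    "rho \<sigma> zm = (edge (\<sigma> 3) (\<sigma> 1) :: 'k rf ^ 2 ^ 2)"
  using admissible_ratio[OF assms, where 'k = 'k] by (simp_all add: rho_def two_rf)

lemma edge_ratio:
  assumes "\<sigma> \<in> S4"
  shows "edge (\<sigma> 0) (\<sigma> 3) = smat (ratio \<sigma>) (edge (\<sigma> 2) (\<sigma> 3) :: 'k rf ^ 2 ^ 2)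
      + smat (ratio \<sigma> - 1) (edge (\<sigma> 3) (\<sigma> 1))"
  unfolding edge_def ratio_def
  by (rule eig_cratio; rule pdet_perm[OF assms]; simp)

lemma rho_edge_0:
  assumes "\<sigma> \<in> S4"
  shows "rho \<sigma> (edge 0 3) = (edge (\<sigma> 0) (\<sigma> 3) :: 'k rf ^ 2 ^ 2)"
    "rho \<sigma> (edge 0 1) = (edge (\<sigma> 0) (\<sigma> 1) :: 'k rf ^ 2 ^ 2)"
    "rho \<sigma> (edge 0 2) = (edge (\<sigma> 0) (\<sigma> 2) :: 'k rf ^ 2 ^ 2)"
proof -
  let ?p = "\<lambda>i. pt (\<sigma> i) :: 'k rf \<times> 'k rf" and ?s = "ratio \<sigma> :: 'k rf"
  note ad = admissible_ratio[OF assms, where 'k = 'k]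
  have rot: "cratio (?p 0) (?p 2) (?p 3) (?p 1) = 1 - 1 / ?s"
      "cratio (?p 0) (?p 3) (?p 1) (?p 2) = 1 / (1 - ?s)"
    unfolding ratio_def by (rule cratio_rotate; rule pdet_perm[OF assms]; simp)+
  have t: "subst_rf ?s t1 = 1 - 1 / ?s" "subst_rf ?s t2 = 1 / (1 - ?s)"
    using ad by (simp_all add: t1_def t2_def subst_rf_diff subst_rf_inverse Aset_diff)
  have e1: "edge (\<sigma> 0) (\<sigma> 1) = smat (1 - 1 / ?s) (edge (\<sigma> 3) (\<sigma> 1))
      + smat (1 - 1 / ?s - 1) (edge (\<sigma> 1) (\<sigma> 2))"
    unfolding edge_def rot[symmetric] by (rule eig_cratio; rule pdet_perm[OF assms]; simp)
  have e2: "edge (\<sigma> 0) (\<sigma> 2) = smat (1 / (1 - ?s)) (edge (\<sigma> 1) (\<sigma> 2))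
      + smat (1 / (1 - ?s) - 1) (edge (\<sigma> 2) (\<sigma> 3))"
    unfolding edge_def rot[symmetric] by (rule eig_cratio; rule pdet_perm[OF assms]; simp)
  note lin = rho_add[OF assms] rho_smat[OF assms] rho_basis[OF assms] gset_smat gset_basis Aset_diff
    t1_in_Aset t2_in_Aset subst_rf_diff ad t
  show "rho \<sigma> (edge 0 3) = (edge (\<sigma> 0) (\<sigma> 3) :: 'k rf ^ 2 ^ 2)"
    unfolding edge_0 edge_ratio[OF assms] by (simp add: lin)
  show "rho \<sigma> (edge 0 1) = (edge (\<sigma> 0) (\<sigma> 1) :: 'k rf ^ 2 ^ 2)"
    unfolding edge_0 e1 by (simp add: lin)
  show "rho \<sigma> (edge 0 2) = (edge (\<sigma> 0) (\<sigma> 2) :: 'k rf ^ 2 ^ 2)"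
    unfolding edge_0 e2 by (simp add: lin)
qed

lemma rho_edge:
  assumes "\<sigma> \<in> S4" "i \<in> {0..3}" "j \<in> {0..3}" "i \<noteq> j"
  shows "rho \<sigma> (edge i j) = (edge (\<sigma> i) (\<sigma> j) :: 'k rf ^ 2 ^ 2)"
proof -
  have swap: "rho \<sigma> (edge j i) = (edge (\<sigma> j) (\<sigma> i) :: 'k rf ^ 2 ^ 2)"
    if "rho \<sigma> (edge i j) = (edge (\<sigma> i) (\<sigma> j) :: 'k rf ^ 2 ^ 2)" "i \<in> {0..3}" "j \<in> {0..3}" "i \<noteq> j" for i j
    using that rho_minus[OF assms(1) edge_gset[OF that(2-4)]] edge_swap by metis
  note f = rho_edge_0[OF assms(1)] rho_basis[OF assms(1), folded edge_basis]
  note g = f[THEN swap]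
  show ?thesis
    using assms(2-4) unfolding atMost_3_cases by (elim disjE; simp add: f g[simplified] f[simplified])
qed

lemma rho_gset:
  assumes "\<sigma> \<in> S4" "M \<in> (gset :: ('k rf ^ 2 ^ 2) set)"
  shows "rho \<sigma> M \<in> gset"
proof -
  have "edge (\<sigma> i) (\<sigma> j) \<in> (gset :: ('k rf ^ 2 ^ 2) set)" if "i \<in> {0..3}" "j \<in> {0..3}" "i \<noteq> j" for i j
    using that assms(1) by (simp add: edge_gset S4_in S4_eq_iff del: atLeastAtMost_iff)
  then show ?thesis
    unfolding rho_def using coords_Aset[OF assms(2)] admissible_ratio[OF assms(1), where 'k = 'k]
    by (intro gset_add gset_smat) (simp_all add: subst_rf_in_Aset)
qed

lemma ratio_comp:
  assumes "\<sigma> \<in> S4" "\<pi> \<in> S4"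
  shows "subst_rf (ratio \<sigma>) (ratio \<pi>) = (ratio (\<sigma> \<circ> \<pi>) :: 'k rf)"
proof -
  let ?E = "\<lambda>i j. edge (\<sigma> (\<pi> i)) (\<sigma> (\<pi> j)) :: 'k rf ^ 2 ^ 2"
  let ?s = "subst_rf (ratio \<sigma>) (ratio \<pi>) :: 'k rf"
  note S = S4_comp[OF assms]
  have A: "(ratio \<pi> :: 'k rf) \<in> Aset" and ad: "admissible (ratio \<sigma> :: 'k rf)"
    using admissible_ratio assms unfolding admissible_def by blast+
  have g: "edge (\<pi> i) (\<pi> j) \<in> (gset :: ('k rf ^ 2 ^ 2) set)" "rho \<sigma> (edge (\<pi> i) (\<pi> j)) = ?E i j"
    if "i \<in> {0..3}" "j \<in> {0..3}" "i \<noteq> j" for i j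
    using that by (simp_all add: edge_gset rho_edge[OF assms(1)] S4_in[OF assms(2)] S4_eq_iff[OF assms(2)]
        del: atLeastAtMost_iff)
  have "rho \<sigma> (edge (\<pi> 0) (\<pi> 3)) = smat ?s (rho \<sigma> (edge (\<pi> 2) (\<pi> 3))) + smat (?s - 1) (rho \<sigma> (edge (\<pi> 3) (\<pi> 1)))"
    unfolding edge_ratio[OF assms(2)]
    by (simp add: rho_add[OF assms(1)] rho_smat[OF assms(1)] gset_smat g A Aset_diff subst_rf_diff ad)
  then have "?E 0 3 = smat ?s (?E 2 3) + smat (?s - 1) (?E 3 1)"
    by (simp add: g)
  moreover have "?E 0 3 = smat (ratio (\<sigma> \<circ> \<pi>)) (?E 2 3) + smat (ratio (\<sigma> \<circ> \<pi>) - 1) (?E 3 1)"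
    using edge_ratio[OF S] by simp
  ultimately have "smat (?s - ratio (\<sigma> \<circ> \<pi>)) (?E 2 3 + ?E 3 1) = 0"
    by (simp add: mat_eq_iff algebra_simps)
  moreover have "?E 2 3 + ?E 3 1 \<noteq> 0"
    unfolding edge_def
    by (rule eig_add_neq_0[OF _ _ _ two_rf]; rule pdet_perm[OF S, unfolded comp_def]; simp)
  ultimately show ?thesis
    by (metis smat_cancel smat_zero_right right_minus_eq)
qed

lemma rho_comp:
  assumes "\<sigma> \<in> S4" "\<pi> \<in> S4" "M \<in> (gset :: ('k rf ^ 2 ^ 2) set)"
  shows "rho (\<sigma> \<circ> \<pi>) M = rho \<sigma> (rho \<pi> M)"
proof -
  have ad: "admissible (ratio \<sigma> :: 'k rf)" "admissible (ratio \<pi> :: 'k rf)"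
    using admissible_ratio assms by blast+
  note c = coords_Aset[OF assms(3)]
  have g: "edge (\<pi> i) (\<pi> j) \<in> (gset :: ('k rf ^ 2 ^ 2) set)"
    "rho \<sigma> (edge (\<pi> i) (\<pi> j)) = (edge (\<sigma> (\<pi> i)) (\<sigma> (\<pi> j)) :: 'k rf ^ 2 ^ 2)"
    if "i \<in> {0..3}" "j \<in> {0..3}" "i \<noteq> j" for i j
    using that by (simp_all add: edge_gset rho_edge[OF assms(1)] S4_in[OF assms(2)] S4_eq_iff[OF assms(2)]
        del: atLeastAtMost_iff)
  show ?thesis
    unfolding rho_def[of \<pi>] rho_def[of "\<sigma> \<circ> \<pi>"]
    by (simp add: rho_add[OF assms(1)] rho_smat[OF assms(1)] gset_smat gset_add g c subst_rf_in_Aset ad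
        subst_rf_subst_rf[OF ad ratio_comp[OF assms(1,2)]])
qed

lemma ratio_id: "ratio id = T"
  by (simp add: ratio_def cratio_def pt_def pdet_def)

lemma rho_id: "M \<in> (gset :: ('k rf ^ 2 ^ 2) set) \<Longrightarrow> rho id M = M"
  using trace0_expand[OF two_rf gset_trace0, of M] coords_Aset[of M]
  by (simp add: rho_def ratio_id subst_rf_T_id edge_basis[simplified])

lemma rho_bij:
  assumes "\<sigma> \<in> S4"
  shows "bij_betw (rho \<sigma>) (gset :: ('k rf ^ 2 ^ 2) set) gset"
proof (rule bij_betw_byWitness[where f' = "rho (inv \<sigma>)"])
  have p: "\<sigma> permutes {0, 1, 2, 3}"
    using assms by (simp add: S4_def)
  have i: "inv \<sigma> \<circ> \<sigma> = id" "\<sigma> \<circ> inv \<sigma> = id"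
    using permutes_inv_o[OF p] by auto
  show "\<forall>M\<in>gset. rho (inv \<sigma>) (rho \<sigma> M) = (M :: 'k rf ^ 2 ^ 2)"
    using rho_comp[OF S4_inv[OF assms] assms] rho_id unfolding i by metis
  show "\<forall>M\<in>gset. rho \<sigma> (rho (inv \<sigma>) M) = (M :: 'k rf ^ 2 ^ 2)"
    using rho_comp[OF assms S4_inv[OF assms]] rho_id unfolding i by metis
qed (use rho_gset assms S4_inv in blast)+

lemma rho_brk:
  assumes "\<sigma> \<in> S4" "M \<in> gset" "N \<in> (gset :: ('k rf ^ 2 ^ 2) set)"
  shows "rho \<sigma> (brk M N) = brk (rho \<sigma> M) (rho \<sigma> N)"
proof -
  have "sl2_triple (edge (\<sigma> 1) (\<sigma> 2)) (edge (\<sigma> 2) (\<sigma> 3)) (edge (\<sigma> 3) (\<sigma> 1) :: 'k rf ^ 2 ^ 2)"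
    unfolding sl2_triple_def edge_def by (intro conjI; rule eig_brk; rule pdet_perm[OF assms(1)]; simp)
  note brk = sl2_triple_brk[OF this]
  show ?thesis
    unfolding rho_def[of \<sigma> M] rho_def[of \<sigma> N] brk
    using admissible_ratio[OF assms(1), where 'k = 'k] assms(2,3)
    by (simp add: rho_def coords_brk[OF two_rf] gset_trace0 coords_Aset subst_rf_add subst_rf_diff
        subst_rf_mult Aset_mult Aset_diff Aset_add)
qed

lemma lie_aut_rho:
  assumes "\<sigma> \<in> S4" "K \<subseteq> Aset" "\<And>a. a \<in> K \<Longrightarrow> subst_rf (ratio \<sigma>) a = a"
  shows "lie_aut K (gset :: ('k rf ^ 2 ^ 2) set) (rho \<sigma>)"
  unfolding lie_aut_def
  using assms by (auto simp: rho_bij rho_brk rho_semilinear subset_iff)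

lemma rho_inj:
  assumes "\<sigma> \<in> S4" "\<pi> \<in> S4" "\<sigma> \<noteq> \<pi>"
  shows "\<exists>M\<in>gset. rho \<sigma> M \<noteq> (rho \<pi> M :: 'k rf ^ 2 ^ 2)"
proof -
  obtain i where i: "\<sigma> i \<noteq> \<pi> i"
    using assms(3) by blast
  have "i \<in> {0, 1, 2, 3}"
    using assms i unfolding S4_def by (metis mem_Collect_eq permutes_not_in)
  then have i3: "i \<in> {0..3}"
    by auto
  obtain j where j: "j \<in> {0..3::nat}" "i \<noteq> j"
    by (cases "i = 0") (use that[of 1] that[of 0] in auto)
  have "rho \<sigma> (edge i j) \<noteq> (rho \<pi> (edge i j) :: 'k rf ^ 2 ^ 2)"
  proof
    assume "rho \<sigma> (edge i j) = (rho \<pi> (edge i j) :: 'k rf ^ 2 ^ 2)"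
    then have "eig (pt (\<sigma> i)) (pt (\<sigma> j)) = (eig (pt (\<pi> i)) (pt (\<pi> j)) :: 'k rf ^ 2 ^ 2)"
      using rho_edge assms(1,2) i3 j unfolding edge_def by metis
    then have "pdet (pt (\<sigma> i)) (pt (\<pi> i)) = (0 :: 'k rf)"
      by (rule pdet_eq_0_if_eig_eq[OF _ _ _ two_rf]) (use pdet_perm(1) assms(1,2) i3 j in blast)+
    then show False
      using pdet_pt_unit(1)[OF S4_in[OF assms(1) i3] S4_in[OF assms(2) i3] i, where 'k = 'k] by simp
  qed
  then show ?thesis
    using edge_gset[OF i3 j] by blast
qed

end

lemma S4_elements:
  "c123 \<in> S4" "transpose 1 2 \<in> S4"
  "transpose 1 2 \<circ> transpose 3 0 \<in> S4"
  "transpose 2 3 \<circ> transpose 1 0 \<in> S4"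
proof -
  have c: "c123 = transpose 1 2 \<circ> transpose 2 3"
    by (auto simp: c123_def Transposition.transpose_def)
  have "transpose i j \<in> S4" if "i \<in> {0, 1, 2, 3}" "j \<in> {0, 1, 2, 3}" for i j
    using permutes_swap_id[OF that] by (simp add: S4_def)
  then show "c123 \<in> S4" "transpose 1 2 \<in> S4"
    "transpose 1 2 \<circ> transpose 3 0 \<in> S4" "transpose 2 3 \<circ> transpose 1 0 \<in> S4"
    unfolding c by (simp_all add: S4_comp)
qed

lemma ratio_elements:
  "ratio c123 = t1" "ratio (transpose 1 2) = 1 - T"
  "ratio (transpose 1 2 \<circ> transpose 3 0) = T"
  "ratio (transpose 2 3 \<circ> transpose 1 0) = T"
  by (simp_all add: ratio_def cratio_def pt_def pdet_def c123_def Transposition.transpose_def t1_def divide_simps)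

lemma is_Psi_edge:
  assumes "tetra_gen sc lb Xg" "is_Psi sc lb Xg Psi" "i \<in> {0..3}" "j \<in> {0..3}" "i \<noteq> j"
  shows "Psi (Xg i j) = edge i j"
proof -
  have sc1: "sc 1 u = u" for u
    using assms(1) by (simp add: tetra_gen_def lie_algebra_def)
  have lin: "Psi (sc a u + v) = smat (emb a) (Psi u) + Psi v" for a u v
    using assms(2) by (simp add: is_Psi_def)
  have add: "Psi (u + v) = Psi u + Psi v" for u v
    using lin[of 1 u v] by (simp add: sc1)
  then have zero: "Psi 0 = 0"
    by (metis add_0 add_cancel_right_right)
  have swap: "Psi (Xg j i) = edge j i" if "Psi (Xg i j) = edge i j" "i \<in> {0..3}" "j \<in> {0..3}" "i \<noteq> j" for i j
  proof -
    have "Xg i j + Xg j i = 0"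
      using assms(1) that(2-4) by (simp add: tetra_gen_def)
    then have "Psi (Xg i j) + Psi (Xg j i) = 0"
      using add zero by metis
    then show ?thesis
      using that(1) edge_swap by (metis eq_neg_iff_add_eq_0 add.commute)
  qed
  have f: "Psi (Xg 1 2) = edge 1 2" "Psi (Xg 2 3) = edge 2 3" "Psi (Xg 3 1) = edge 3 1"
      "Psi (Xg 0 3) = edge 0 3" "Psi (Xg 0 1) = edge 0 1" "Psi (Xg 0 2) = edge 0 2"
    using assms(2) unfolding is_Psi_def by (simp_all only: edge_basis edge_0 XYZ_eq)
  note g = f[THEN swap]
  show ?thesis
    using assms(3-5) unfolding atMost_3_cases by (elim disjE; simp add: f[simplified] g[simplified])
qed

lemma is_Psi_equivariant:
  assumes two: "(2::'k::field) \<noteq> 0"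
    and gen: "tetra_gen (sc :: 'k \<Rightarrow> 'l::ab_group_add \<Rightarrow> 'l) lb Xg"
    and act: "tetra_action sc lb Xg act" and Psi: "is_Psi sc lb Xg Psi" and \<sigma>: "\<sigma> \<in> S4"
  shows "Psi (act \<sigma> u) = rho \<sigma> (Psi u)"
proof -
  have sc: "sc 1 u = u" for u
    using gen by (simp add: tetra_gen_def lie_algebra_def)
  have lin: "Psi (sc a u + v) = smat (emb a) (Psi u) + Psi v" and Pbrk: "Psi (lb u v) = brk (Psi u) (Psi v)" for a u v
    using Psi by (simp_all add: is_Psi_def)
  have add: "Psi (u + v) = Psi u + Psi v" for u v
    using lin[of 1 u v] by (simp add: sc)
  have zero: "Psi 0 = 0"
    using add[of 0 0] by simp
  have scale: "Psi (sc a u) = smat (emb a) (Psi u)" for a u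
    using lin[of a u 0] by (simp add: zero)
  have alin: "act \<sigma> (sc a u + v) = sc a (act \<sigma> u) + act \<sigma> v"
    and abrk: "act \<sigma> (lb u v) = lb (act \<sigma> u) (act \<sigma> v)" for a u v
    using act \<sigma> unfolding tetra_action_def by blast+
  have aadd: "act \<sigma> (u + v) = act \<sigma> u + act \<sigma> v" for u v
    using alin[of 1 u v] by (simp add: sc)
  have azero: "act \<sigma> 0 = 0"
    using aadd[of 0 0] by simp
  have ascale: "act \<sigma> (sc a u) = sc a (act \<sigma> u)" for a u
    using alin[of a u 0] by (simp add: azero)
  have "u \<in> lie_span sc lb {Xg i j | i j. i \<in> {0..3} \<and> j \<in> {0..3} \<and> i \<noteq> j}"
    using gen by (simp add: tetra_gen_def)
  then have "Psi u \<in> gset \<and> Psi (act \<sigma> u) = rho \<sigma> (Psi u)"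
  proof induction
    case (gen u)
    then obtain i j where ij: "u = Xg i j" "i \<in> {0..3}" "j \<in> {0..3}" "i \<noteq> j"
      by blast
    then have "act \<sigma> u = Xg (\<sigma> i) (\<sigma> j)"
      using act \<sigma> unfolding tetra_action_def by blast
    moreover have "\<sigma> i \<in> {0..3}" "\<sigma> j \<in> {0..3}" "\<sigma> i \<noteq> \<sigma> j"
      using ij S4_in[OF \<sigma>] S4_eq_iff[OF \<sigma>] by blast+
    ultimately show ?case
      using ij is_Psi_edge[OF \<open>tetra_gen sc lb Xg\<close> Psi] edge_gset rho_edge[OF two \<sigma>] by metis
  next
    case zero
    then show ?case
      by (simp add: \<open>Psi 0 = 0\<close> azero gset_0 rho_0[OF two \<sigma>])
  next
    case (add u v)
    then show ?case
      by (simp add: \<open>\<And>u v. Psi (u + v) = Psi u + Psi v\<close> aadd gset_add rho_add[OF two \<sigma>])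
  next
    case (scale u a)
    then show ?case
      by (simp add: \<open>\<And>a u. Psi (sc a u) = smat (emb a) (Psi u)\<close> ascale gset_smat rho_smat[OF two \<sigma>]
          admissible_ratio[OF \<sigma>])
  next
    case (brk u v)
    then show ?case
      by (simp add: Pbrk abrk gset_brk rho_brk[OF two \<sigma>])
  qed
  then show ?thesis ..
qed

lemma rho_values:
  assumes "(2::'k::field) \<noteq> 0"
  shows "rho c123 = (tens phiS phiA :: 'k rf ^ 2 ^ 2 \<Rightarrow> _)"
    "rho (transpose 1 2) = (tens tauS tauA :: 'k rf ^ 2 ^ 2 \<Rightarrow> _)"
    "M \<in> gset \<Longrightarrow> rho (transpose 1 2 \<circ> transpose 3 0) M = (tau1 M :: 'k rf ^ 2 ^ 2)"
    "M \<in> gset \<Longrightarrow> rho (transpose 2 3 \<circ> transpose 1 0) M = (tau2 M :: 'k rf ^ 2 ^ 2)"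
proof -
  have s: "edge 2 1 = - (xm :: 'k rf ^ 2 ^ 2)" "edge 3 2 = - (ym :: 'k rf ^ 2 ^ 2)" "edge 1 3 = - (zm :: 'k rf ^ 2 ^ 2)"
    by (metis edge_basis edge_swap)+
  have s0: "edge i 0 = - (edge 0 i :: 'k rf ^ 2 ^ 2)" for i
    by (rule edge_swap)
  have l: "lift xm = (xm :: 'k rf ^ 2 ^ 2)" "lift ym = (ym :: 'k rf ^ 2 ^ 2)" "lift zm = (zm :: 'k rf ^ 2 ^ 2)"
    "lift (- N) = - lift N" for N :: "'k ^ 2 ^ 2"
    using XYZ_eq by (simp_all add: X_def Y_def Z_def) (simp add: lift_def vec_eq_iff)
  note simps = s edge_basis l phiS_tauS_basis[OF assms] ratio_elements
  show "rho c123 = (tens phiS phiA :: 'k rf ^ 2 ^ 2 \<Rightarrow> _)"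
    by (simp add: fun_eq_iff rho_def tens_def c123_def simps simps[simplified] phiA_def)
  show "rho (transpose 1 2) = (tens tauS tauA :: 'k rf ^ 2 ^ 2 \<Rightarrow> _)"
    by (simp add: fun_eq_iff rho_def tens_def Transposition.transpose_def simps simps[simplified] tauA_def)
  show "rho (transpose 1 2 \<circ> transpose 3 0) M = (tau1 M :: 'k rf ^ 2 ^ 2)" if "M \<in> gset"
    unfolding rho_def ratio_elements using coords_Aset[OF assms that]
    by (simp add: tau1_def lin3_def subst_rf_T_id Transposition.transpose_def simps simps[simplified] s0 edge_0
        edge_0[simplified] XYZ_eq)
  show "rho (transpose 2 3 \<circ> transpose 1 0) M = (tau2 M :: 'k rf ^ 2 ^ 2)" if "M \<in> gset"
    unfolding rho_def ratio_elements using coords_Aset[OF assms that]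
    by (simp add: tau2_def lin3_def subst_rf_T_id Transposition.transpose_def simps simps[simplified] s0 edge_0
        edge_0[simplified] XYZ_eq)
qed

lemma lie_aut_cong: "(\<And>M. M \<in> S \<Longrightarrow> f M = g M) \<Longrightarrow> (\<And>M N. M \<in> S \<Longrightarrow> N \<in> S \<Longrightarrow> brk M N \<in> S) \<Longrightarrow>
    (\<And>c M N. c \<in> K \<Longrightarrow> M \<in> S \<Longrightarrow> N \<in> S \<Longrightarrow> smat c M + N \<in> S) \<Longrightarrow> lie_aut K S f \<Longrightarrow> lie_aut K S g"
  unfolding lie_aut_def using bij_betw_cong[of S f g S] by simp

lemma lie_aut_tau:
  assumes two: "(2::'k::field) \<noteq> 0"
  shows "lie_aut Aset gset (tau1 :: 'k rf ^ 2 ^ 2 \<Rightarrow> _)" "lie_aut Aset gset (tau2 :: 'k rf ^ 2 ^ 2 \<Rightarrow> _)"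
proof -
  have cong: "lie_aut Aset gset f" if "\<And>M. M \<in> gset \<Longrightarrow> rho \<sigma> M = f M" "\<sigma> \<in> S4" "ratio \<sigma> = (T :: 'k rf)"
    for \<sigma> and f :: "'k rf ^ 2 ^ 2 \<Rightarrow> 'k rf ^ 2 ^ 2"
  proof (rule lie_aut_cong)
    show "lie_aut Aset gset (rho \<sigma> :: 'k rf ^ 2 ^ 2 \<Rightarrow> _)"
      by (rule lie_aut_rho[OF two that(2)]) (simp_all add: that(3) subst_rf_T_id)
  qed (simp_all add: that(1) gset_brk gset_add gset_smat)
  show "lie_aut Aset gset (tau1 :: 'k rf ^ 2 ^ 2 \<Rightarrow> _)"
    by (rule cong[OF rho_values(3)[OF two] S4_elements(3) ratio_elements(3)])
  show "lie_aut Aset gset (tau2 :: 'k rf ^ 2 ^ 2 \<Rightarrow> _)"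
    by (rule cong[OF rho_values(4)[OF two] S4_elements(4) ratio_elements(4)])
qed

theorem theorem1p1:
  assumes "CHAR('k::field) \<noteq> 2"
  shows
   "lie_aut (UNIV :: 'k set) sl2 (phiS :: 'k ^ 2 ^ 2 \<Rightarrow> _) \<and> order_on (sl2 :: ('k ^ 2 ^ 2) set) phiS 3 \<and>
    lie_aut (UNIV :: 'k set) sl2 (tauS :: 'k ^ 2 ^ 2 \<Rightarrow> _) \<and> order_on (sl2 :: ('k ^ 2 ^ 2) set) tauS 2 \<and>
    alg_aut_A (phiA :: 'k rf \<Rightarrow> _) \<and> order_on (Aset :: 'k rf set) phiA 3 \<and>
    alg_aut_A (tauA :: 'k rf \<Rightarrow> _) \<and> order_on (Aset :: 'k rf set) tauA 2 \<and>
    lie_aut Aset gset (tau1 :: 'k rf ^ 2 ^ 2 \<Rightarrow> _) \<and>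
    lie_aut Aset gset (tau2 :: 'k rf ^ 2 ^ 2 \<Rightarrow> _) \<and>
    (\<exists>\<rho> :: (nat \<Rightarrow> nat) \<Rightarrow> 'k rf ^ 2 ^ 2 \<Rightarrow> 'k rf ^ 2 ^ 2.
       (\<forall>\<sigma>\<in>S4. lie_aut (range emb) gset (\<rho> \<sigma>)) \<and>
       (\<forall>\<sigma>\<in>S4. \<forall>\<pi>\<in>S4. \<forall>M\<in>gset. \<rho> (\<sigma> \<circ> \<pi>) M = \<rho> \<sigma> (\<rho> \<pi> M)) \<and>
       (\<forall>\<sigma>\<in>S4. \<forall>\<pi>\<in>S4. \<sigma> \<noteq> \<pi> \<longrightarrow> (\<exists>M\<in>gset. \<rho> \<sigma> M \<noteq> \<rho> \<pi> M)) \<and>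
       (\<forall>M\<in>gset. \<rho> c123 M = tens phiS phiA M) \<and>
       (\<forall>M\<in>gset. \<rho> (transpose 1 2) M = tens tauS tauA M) \<and>
       (\<forall>M\<in>gset. \<rho> (transpose 1 2 \<circ> transpose 3 0) M = tau1 M) \<and>
       (\<forall>M\<in>gset. \<rho> (transpose 2 3 \<circ> transpose 1 0) M = tau2 M) \<and>
       (\<forall>a\<in>Aset. \<forall>M\<in>gset. \<rho> c123 (smat a M) = smat (phiA a) (\<rho> c123 M)) \<and>
       (\<forall>a\<in>Aset. \<forall>M\<in>gset. \<rho> (transpose 1 2) (smat a M) = smat (tauA a) (\<rho> (transpose 1 2) M)) \<and>
       (\<forall>(sc :: 'k \<Rightarrow> 'l::ab_group_add \<Rightarrow> 'l) lb Xg act Psi.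
          tetra_gen sc lb Xg \<and> tetra_action sc lb Xg act \<and> is_Psi sc lb Xg Psi \<longrightarrow>
          (\<forall>\<sigma>\<in>S4. \<forall>u. Psi (act \<sigma> u) = \<rho> \<sigma> (Psi u))))"
proof -
  note two = two_neq_zero_of_CHAR[OF assms]
  have aut: "lie_aut (range emb) gset (rho \<sigma> :: 'k rf ^ 2 ^ 2 \<Rightarrow> _)" if "\<sigma> \<in> S4" for \<sigma>
    using that by (rule lie_aut_rho[OF two]) (auto simp: admissible_ratio[OF that])
  have semi: "rho c123 (smat a M) = smat (phiA a) (rho c123 M)"
    "rho (transpose 1 2) (smat a M) = smat (tauA a) (rho (transpose 1 2) M)"
    if "a \<in> Aset" "M \<in> gset" for a and M :: "'k rf ^ 2 ^ 2"
    using rho_smat[OF two S4_elements(1) that] rho_smat[OF two S4_elements(2) that]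
    by (simp_all only: ratio_elements phiA_def tauA_def)
  show ?thesis
    by (intro conjI constant_automorphisms[OF two] algebra_automorphisms lie_aut_tau[OF two]
        exI[where x = rho] ballI allI impI aut rho_comp[OF two] rho_inj[OF two] semi
        rho_values(3,4)[OF two];
        (assumption | simp only: rho_values(1,2)[OF two] | elim conjE; rule is_Psi_equivariant[OF two]))
qed

end
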